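(* Consider the balanced DHV network, with $m_1+m_4=m_2+m_5=m_3+m_6=1$. There exists $\bar\alpha\in(0,1)$ (depending on the mean service times $m_1,\dots,m_6$) such that if $\alpha_1>\bar\alpha$ and (i) the nominal-load conditions are satisfied: $\rho_1=\rho_2=\rho_3<1$ (equivalently, $\alpha_1<1$), (ii) $m_2+m_4+m_6<2$, then the network satisfies state-space collapse under any queue-ratio policy, i.e., under every ratio matrix $\Delta$.
   Context: DHV network: $J=3$ stations, $K=6$ classes. Jobs arrive exogenously only to class $1$, at rate $\alpha_1$, and follow the deterministic route $1\to2\to3\to4\to5\to6\to$ exit (so $P_{k,k+1}=1$ for $k=1,\dots,5$, all other $P_{kl}=0$, $\alpha=(\alpha_1,0,\dots,0)'$). Station 1 serves classes $1,4$; station 2 serves $2,5$; station 3 serves $3,6$; $s(k)$ is the station serving class $k$. $m_k>0$ is the mean service time of class $k$, $M=\mathrm{diag}(m_1,\dots,m_6)$, $C$ is the $3\times6$ matrix with $C_{jk}=1$ if $s(k)=j$ and $0$ otherwise, $\rho=CM(I-P')^{-1}\alpha$, $e$ is the all-ones vector. The network is balanced if all $\rho_j$ are equal; time is normalized so that the common value of $m_1+m_4$, $m_2+m_5$, $m_3+m_6$ is $1$. A ratio matrix (encoding a queue-ratio policy) is a nonnegative $K\times J$ matrix $\Delta$ with $\Delta_{kj}=0$ if $s(k)\ne j$, and $CM\Delta=I$. Fluid model under $\Delta$. A solution consists of Lipschitz functions on $[0,\infty)$ satisfying: $\bar Z(t)=\bar Z(0)+\alpha t-(I-P')M^{-1}\bar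 T(t)\ge 0$; $\bar W(t)=CM\bar Z(t)$; $\bar\epsilon(t)=\bar Z(t)-\Delta\bar W(t)$; $\bar T(0)=0$ and $\bar T$ is nondecreasing; $\bar Y(t)=et-C\bar T(t)$ is nondecreasing; $\int_0^\infty \bar W_j(s)\,d\bar Y_j(s)=0$ for each $j$; and for each class $k$ and each time $t$ of differentiability, $\bar\epsilon_k^+(t)\bigl(1-\dot{\bar T}{}_k^+(t)\bigr)=0$, where $\bar\epsilon_k^+(t)=\sum_{i\le k:\,s(i)=s(k),\,\bar\epsilon_i(t)>0}\bar\epsilon_i(t)$ and $\dot{\bar T}{}_k^+(t)=\sum_{i\le k:\,s(i)=s(k),\,\bar\epsilon_i(t)>0}\dot{\bar T}_i(t)$. State-space collapse under $\Delta$: for every fluid solution there is $t_0\ge0$ (possibly depending on $\bar Z(0)$) with $\bar Z(t)=\Delta\bar W(t)$ for all $t\ge t_0$. *)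

theory Defs
  imports "HOL-Analysis.Analysis"
begin

section \<open>Multiclass queueing networks\<close>

text \<open>
  A network is given by its routing matrix \<open>P\<close>, the station \<open>s k\<close> serving class \<open>k\<close>, the mean
  service times \<open>m\<close> and the exogenous arrival rates \<open>\<alpha>\<close>.  Classes are indexed by \<open>'k\<close> (whose order
  is the numbering of the classes), stations by \<open>'j\<close>.
\<close>

definition service_matrix :: "real ^ 'k \<Rightarrow> real ^ 'k ^ 'k"
  where "service_matrix m = (\<chi> k l. if k = l then m $ k else 0)"

definition constituency_matrix :: "('k \<Rightarrow> 'j) \<Rightarrow> real ^ 'k ^ 'j"
  where "constituency_matrix s = (\<chi> j k. if s k = j then 1 else 0)"

definition traffic_intensity ::
    "real ^ 'k ^ 'k \<Rightarrow> ('k::finite \<Rightarrow> 'j::finite) \<Rightarrow> real ^ 'k \<Rightarrow> real ^ 'k \<Rightarrow> real ^ 'j"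
  where "traffic_intensity P s m \<alpha> =
    (constituency_matrix s ** service_matrix m ** matrix_inv (mat 1 - transpose P)) *v \<alpha>"

definition ratio_matrix ::
    "('k::finite \<Rightarrow> 'j::finite) \<Rightarrow> real ^ 'k \<Rightarrow> real ^ 'j ^ 'k \<Rightarrow> bool"
  where "ratio_matrix s m \<Delta> \<longleftrightarrow>
    (\<forall>k j. 0 \<le> \<Delta> $ k $ j) \<and>
    (\<forall>k j. s k \<noteq> j \<longrightarrow> \<Delta> $ k $ j = 0) \<and>
    constituency_matrix s ** service_matrix m ** \<Delta> = mat 1"


section \<open>The fluid model under a ratio matrix\<close>

text \<open>
  The notation \<open>real ^ 'k\<close> insists on the sort \<open>finite\<close> for \<open>'k\<close>, so it cannot be combined
  with the sort \<open>{finite, linorder}\<close>.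
\<close>

type_synonym 'k rvector = "(real, 'k) vec"
type_synonym ('k, 'j) rmatrix = "((real, 'j) vec, 'k) vec"

definition excess_classes ::
    "('k::{finite,linorder} \<Rightarrow> 'j) \<Rightarrow> 'k rvector \<Rightarrow> 'k \<Rightarrow> 'k set"
  where "excess_classes s e k = {i. i \<le> k \<and> s i = s k \<and> 0 < e $ i}"

text \<open>
  All functions matter on \<open>[0, \<infinity>)\<close> only.  The Stieltjes integral of \<open>W\<^sub>j\<close> against \<open>Y\<^sub>j\<close> is taken with
  respect to the Lebesgue-Stieltjes measure of \<open>Y\<^sub>j\<close>, extended to the left of \<open>0\<close> by its value
  at \<open>0\<close>.  The nonnegative integral is used because the Bochner integral of a non-integrable
  function is \<open>0\<close> by convention; nothing is lost, since \<open>W\<^sub>j \<ge> 0\<close>.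
\<close>

definition fluid_solution ::
    "('k, 'k) rmatrix \<Rightarrow> ('k::{finite,linorder} \<Rightarrow> 'j::finite) \<Rightarrow> 'k rvector \<Rightarrow> 'k rvector \<Rightarrow>
     ('k, 'j) rmatrix \<Rightarrow> (real \<Rightarrow> 'k rvector) \<Rightarrow> (real \<Rightarrow> 'j rvector) \<Rightarrow> (real \<Rightarrow> 'k rvector) \<Rightarrow>
     (real \<Rightarrow> 'k rvector) \<Rightarrow> (real \<Rightarrow> 'j rvector) \<Rightarrow> bool"
  where "fluid_solution P s m \<alpha> \<Delta> Z W \<epsilon> T Y \<longleftrightarrow>
    (\<exists>L. L-lipschitz_on {0..} Z) \<and> (\<exists>L. L-lipschitz_on {0..} W) \<and>
    (\<exists>L. L-lipschitz_on {0..} \<epsilon>) \<and> (\<exists>L. L-lipschitz_on {0..} T) \<and>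
    (\<exists>L. L-lipschitz_on {0..} Y) \<and>
    (\<forall>t\<ge>0. Z t = Z 0 + t *\<^sub>R \<alpha> - ((mat 1 - transpose P) ** matrix_inv (service_matrix m)) *v T t) \<and>
    (\<forall>t\<ge>0. \<forall>k. 0 \<le> Z t $ k) \<and>
    (\<forall>t\<ge>0. W t = (constituency_matrix s ** service_matrix m) *v Z t) \<and>
    (\<forall>t\<ge>0. \<epsilon> t = Z t - \<Delta> *v W t) \<and>
    T 0 = 0 \<and>
    (\<forall>k. mono_on {0..} (\<lambda>t. T t $ k)) \<and>
    (\<forall>t\<ge>0. Y t = t *\<^sub>R (\<chi> j. 1) - constituency_matrix s *v T t) \<and>
    (\<forall>j. mono_on {0..} (\<lambda>t. Y t $ j)) \<and>
    (\<forall>j. (\<integral>\<^sup>+ t\<in>{0..}. ennreal (W t $ j) \<partial>interval_measure (\<lambda>t. Y (max 0 t) $ j)) = 0) \<and>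
    (\<forall>t>0. \<forall>T'. (T has_vector_derivative T') (at t) \<longrightarrow>
      (\<forall>k. (\<Sum>i\<in>excess_classes s (\<epsilon> t) k. \<epsilon> t $ i) *
           (1 - (\<Sum>i\<in>excess_classes s (\<epsilon> t) k. T' $ i)) = 0))"

definition state_space_collapse ::
    "('k, 'k) rmatrix \<Rightarrow> ('k::{finite,linorder} \<Rightarrow> 'j::finite) \<Rightarrow> 'k rvector \<Rightarrow> 'k rvector \<Rightarrow>
     ('k, 'j) rmatrix \<Rightarrow> bool"
  where "state_space_collapse P s m \<alpha> \<Delta> \<longleftrightarrow>
    (\<forall>Z W \<epsilon> T Y. fluid_solution P s m \<alpha> \<Delta> Z W \<epsilon> T Y \<longrightarrow>
      (\<exists>t\<^sub>0\<ge>0. \<forall>t\<ge>t\<^sub>0. Z t = \<Delta> *v W t))"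


section \<open>The DHV network\<close>

text \<open>
  The numeral type \<open>6\<close> is not used for the classes, since there \<open>6 = 0\<close> is the least element.
  For the stations, the numeral type \<open>3\<close> is harmless because their order plays no role.
\<close>

datatype dhv_class = K1 | K2 | K3 | K4 | K5 | K6

fun class_number :: "dhv_class \<Rightarrow> nat" where
  "class_number K1 = 1"
| "class_number K2 = 2"
| "class_number K3 = 3"
| "class_number K4 = 4"
| "class_number K5 = 5"
| "class_number K6 = 6"

lemma UNIV_dhv_class: "UNIV = {K1, K2, K3, K4, K5, K6}"
proof -
  have "x \<in> {K1, K2, K3, K4, K5, K6}" for x by (cases x) simp_all
  then show ?thesis by blast
qed

lemma class_number_inject: "class_number k = class_number l \<longleftrightarrow> k = l"
  by (cases k; cases l) simp_all

instance dhv_class :: finite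
  by standard (simp add: UNIV_dhv_class)

instantiation dhv_class :: linorder
begin

definition "k \<le> l \<longleftrightarrow> class_number k \<le> class_number l"
definition "k < l \<longleftrightarrow> class_number k < class_number l"

instance
  by standard (auto simp: less_eq_dhv_class_def less_dhv_class_def class_number_inject[symmetric])

end

fun dhv_station :: "dhv_class \<Rightarrow> 3" where
  "dhv_station K1 = 1"
| "dhv_station K2 = 2"
| "dhv_station K3 = 3"
| "dhv_station K4 = 1"
| "dhv_station K5 = 2"
| "dhv_station K6 = 3"

definition dhv_routing :: "real ^ dhv_class ^ dhv_class"
  where "dhv_routing = (\<chi> k l. if class_number l = class_number k + 1 then 1 else 0)"

definition dhv_arrivals :: "real \<Rightarrow> real ^ dhv_class"
  where "dhv_arrivals \<alpha>\<^sub>1 = (\<chi> k. if k = K1 then \<alpha>\<^sub>1 else 0)"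

abbreviation dhv_traffic_intensity :: "real ^ dhv_class \<Rightarrow> real \<Rightarrow> real ^ 3"
  where "dhv_traffic_intensity m \<alpha>\<^sub>1 \<equiv>
    traffic_intensity dhv_routing dhv_station m (dhv_arrivals \<alpha>\<^sub>1)"

end

theory Submission
  imports Defs
begin

text \<open>
  The overload of a class is the positive part of its imbalance \<open>m\<^sub>k \<epsilon>\<^sub>k\<close>, divided by the share of the
  other class at its station. At most one class of a station is overloaded, and collapse means that
  no class is. An overloaded class gets the full capacity of its station, so its overload grows at
  most at the rate \<open>m\<^sub>k a\<^sub>k - 1\<close>, where \<open>a\<^sub>k\<close> is its arrival rate; without overload, the station
  splits its capacity in such a way that the prescribed queue ratios are kept.

  Class 1 is never overloaded from some time on. If \<open>m\<^sub>2 < m\<^sub>1\<close> or \<open>m\<^sub>6 < m\<^sub>5\<close>, the overloads of the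
  other classes then die out one after the other. In the remaining case overload can only pass
  around a cycle, from class 6 to class 2, from class 2 to class 4, and from class 4 to class 6.
  Weighting the classes 2, 4, 6 by \<open>m\<^sub>1 m\<^sub>5\<close>, \<open>m\<^sub>1 m\<^sub>3\<close>, \<open>m\<^sub>3 m\<^sub>5\<close> balances the three gains exactly when
  \<open>m\<^sub>2 + m\<^sub>4 + m\<^sub>6 = 2\<close>, so below \<open>2\<close> these weights give a piecewise linear Lyapunov function with
  negative drift. Arrival rates \<open>\<alpha>\<^sub>1 < 1\<close> perturb the drift by \<open>O(1 - \<alpha>\<^sub>1)\<close>, uniformly in \<open>\<Delta>\<close>.
\<close>

section \<open>Measures induced by monotone functions\<close>

definition sum_measure :: "'a measure \<Rightarrow> 'a measure \<Rightarrow> 'a measure"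
  where "sum_measure M N = measure_of (space M) (sets M) (\<lambda>A. emeasure M A + emeasure N A)"

lemma sets_sum_measure [simp]: "sets (sum_measure M N) = sets M"
  by (simp add: sum_measure_def)

lemma emeasure_sum_measure:
  assumes "sets N = sets M" and A: "A \<in> sets M"
  shows "emeasure (sum_measure M N) A = emeasure M A + emeasure N A"
  unfolding sum_measure_def
proof (rule emeasure_measure_of_sigma[OF sets.sigma_algebra_axioms _ _ A])
  show "countably_additive (sets M) (\<lambda>A. emeasure M A + emeasure N A)"
    using assms(1) by (intro countably_additiveI) (simp add: suminf_add[symmetric] suminf_emeasure)
qed (simp add: positive_def)

lemma interval_measure_eqI:
  fixes F :: "real \<Rightarrow> real"
  assumes F: "mono F" "\<And>a. continuous (at_right a) F"
    and sets: "sets M = sets borel"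
    and Ioc: "\<And>a b. a \<le> b \<Longrightarrow> emeasure M {a<..b} = ennreal (F b - F a)"
  shows "M = interval_measure F"
proof (rule measure_eqI_generator_eq)
  let ?E = "range (\<lambda>(a, b). {a<..b::real})" and ?A = "\<lambda>n::nat. {- real n<..real n}"
  show "Int_stable ?E" by (auto simp: Int_stable_def)
  show "emeasure M X = emeasure (interval_measure F) X" if "X \<in> ?E" for X
  proof -
    from that obtain a b where "X = {a<..b}" by (auto simp: image_iff split_beta)
    then show ?thesis
      using Ioc emeasure_interval_measure_Ioc_eq[of F] F by (cases "a \<le> b") (auto simp: monoD)
  qed
  show "sets M = sigma_sets UNIV ?E" "sets (interval_measure F) = sigma_sets UNIV ?E"
    by (simp_all add: sets borel_sigma_sets_Ioc)
  show "range ?A \<subseteq> ?E" by auto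
  have "x \<in> (\<Union>n. ?A n)" for x
  proof -
    obtain n where "\<bar>x\<bar> < real n" using reals_Archimedean2 by blast
    then show ?thesis by (intro UN_I[of n]) auto
  qed
  then show "(\<Union>n. ?A n) = UNIV" by blast
  show "emeasure M (?A n) \<noteq> \<infinity>" for n by (simp add: Ioc)
qed simp

lemma interval_measure_add:
  fixes f g :: "real \<Rightarrow> real"
  assumes f: "mono f" "\<And>a. continuous (at_right a) f"
    and g: "mono g" "\<And>a. continuous (at_right a) g"
  shows "interval_measure (\<lambda>x. f x + g x) = sum_measure (interval_measure f) (interval_measure g)"
proof (rule interval_measure_eqI[symmetric])
  show "mono (\<lambda>x. f x + g x)" using f(1) g(1) by (intro monoI add_mono) (auto dest: monoD)
  show "continuous (at_right a) (\<lambda>x. f x + g x)" for a using f(2) g(2) by (intro continuous_add)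
  fix a b :: real assume "a \<le> b"
  then have "emeasure (sum_measure (interval_measure f) (interval_measure g)) {a<..b} =
      ennreal (f b - f a) + ennreal (g b - g a)"
    using f g by (simp add: emeasure_sum_measure emeasure_interval_measure_Ioc monoD)
  also have "\<dots> = ennreal (f b + g b - (f a + g a))"
    using monoD[OF f(1) \<open>a \<le> b\<close>] monoD[OF g(1) \<open>a \<le> b\<close>]
    by (simp add: ennreal_plus[symmetric] del: ennreal_plus)
  finally show "emeasure (sum_measure (interval_measure f) (interval_measure g)) {a<..b} =
      ennreal (f b + g b - (f a + g a))" .
qed simp

lemma interval_measure_cmult:
  assumes "0 \<le> c"
  shows "interval_measure (\<lambda>x. c * x) = scale_measure (ennreal c) lborel"
proof (rule interval_measure_eqI[symmetric])
  show "mono (\<lambda>x. c * x)" using assms by (intro monoI mult_left_mono)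
  show "continuous (at_right a) (\<lambda>x. c * x)" for a by (intro continuous_intros)
  show "emeasure (scale_measure (ennreal c) lborel) {a<..b} = ennreal (c * b - c * a)" if "a \<le> b" for a b
    using that assms by (simp add: ennreal_mult[symmetric] right_diff_distrib)
qed simp

section \<open>Comparison of measures on fine balls\<close>

lemma Vitali_covering_open:
  fixes E U :: "'n::euclidean_space set"
  assumes "open U" "E \<subseteq> U"
    and fine: "\<And>x d. x \<in> E \<Longrightarrow> 0 < d \<Longrightarrow> \<exists>c r. 0 < r \<and> r < d \<and> x \<in> cball c r \<and> P (cball c r)"
  obtains \<B> where "countable \<B>" "disjoint \<B>" "\<Union>\<B> \<subseteq> U" "negligible (E - \<Union>\<B>)"
    "\<And>B. B \<in> \<B> \<Longrightarrow> closed B \<and> P B"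
proof -
  define K where "K = {(c, r). 0 < r \<and> cball c r \<subseteq> U \<and> P (cball c r)}"
  let ?ball = "\<lambda>i::'n \<times> real. cball (fst i) (snd i)"
  obtain I where I: "countable I" "I \<subseteq> K" "pairwise (\<lambda>i j. disjnt (?ball i) (?ball j)) I"
    "negligible (E - (\<Union>i\<in>I. ?ball i))"
  proof (rule Vitali_covering_theorem_cballs[of K snd E fst])
    show "0 < snd i" if "i \<in> K" for i using that by (auto simp: K_def)
    fix x :: 'n and d :: real
    assume "x \<in> E" "0 < d"
    with assms(1,2) obtain k where k: "0 < k" "ball x k \<subseteq> U" using openE by blast
    then obtain c r where cr: "0 < r" "r < min d (k / 2)" "x \<in> cball c r" "P (cball c r)"
      using fine[OF \<open>x \<in> E\<close>, of "min d (k / 2)"] \<open>0 < d\<close> by auto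
    have "cball c r \<subseteq> ball x k"
    proof
      fix y assume "y \<in> cball c r"
      then have "dist x y \<le> r + r"
        using cr(3) dist_triangle2[of x y c] by (simp add: dist_commute)
      then show "y \<in> ball x k" using cr(2) by simp
    qed
    then show "\<exists>i. i \<in> K \<and> x \<in> ?ball i \<and> snd i < d"
      using cr k(2) by (intro exI[of _ "(c, r)"]) (auto simp: K_def)
  qed
  show thesis
  proof (rule that[of "?ball ` I"])
    show "disjoint (?ball ` I)"
      using I(3) by (force simp: disjoint_def pairwise_def disjnt_def)
    show "\<Union>(?ball ` I) \<subseteq> U" using I(2) unfolding K_def by fastforce
  qed (use I(1,2,4) in \<open>auto simp: K_def\<close>)
qed

lemma emeasure_Union_mono:
  assumes "countable \<B>" "disjoint \<B>" and sets: "\<B> \<subseteq> sets M" "sets N = sets M"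
    and le: "\<And>B. B \<in> \<B> \<Longrightarrow> emeasure M B \<le> emeasure N B"
  shows "emeasure M (\<Union>\<B>) \<le> emeasure N (\<Union>\<B>)"
proof -
  have disjoint: "disjoint_family_on (\<lambda>B. B) \<B>"
    using assms(2) by (auto simp: disjoint_family_on_def disjoint_def)
  have "emeasure M (\<Union>\<B>) = (\<integral>\<^sup>+B. emeasure M B \<partial>count_space \<B>)"
    using emeasure_UN_countable[of \<B> "\<lambda>B. B" M] assms(1) disjoint sets by (simp add: subset_iff)
  also have "\<dots> \<le> (\<integral>\<^sup>+B. emeasure N B \<partial>count_space \<B>)"
    using le by (intro nn_integral_mono) auto
  also have "\<dots> = emeasure N (\<Union>\<B>)"
    using emeasure_UN_countable[of \<B> "\<lambda>B. B" N] assms(1) disjoint sets by (simp add: subset_iff)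
  finally show ?thesis .
qed

lemma emeasure_le_of_fine_cballs:
  fixes M N :: "'n::euclidean_space measure"
  assumes sets: "sets M = sets borel" "sets N = sets borel" and E: "E \<in> sets borel"
    and ac: "absolutely_continuous lborel M"
    and outer: "\<And>e. 0 < e \<Longrightarrow> \<exists>U. open U \<and> E \<subseteq> U \<and> emeasure N (U - E) \<le> ennreal e"
    and fine: "\<And>x d. x \<in> E \<Longrightarrow> 0 < d \<Longrightarrow>
      \<exists>c r. 0 < r \<and> r < d \<and> x \<in> cball c r \<and> emeasure M (cball c r) \<le> emeasure N (cball c r)"
  shows "emeasure M E \<le> emeasure N E"
proof (rule ennreal_le_epsilon)
  fix e :: real
  assume "0 < e"
  then obtain U where U: "open U" "E \<subseteq> U" "emeasure N (U - E) \<le> ennreal e" using outer by blast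
  obtain \<B> where \<B>: "countable \<B>" "disjoint \<B>" "\<Union>\<B> \<subseteq> U" and null: "negligible (E - \<Union>\<B>)"
    and le: "\<And>B. B \<in> \<B> \<Longrightarrow> closed B \<and> emeasure M B \<le> emeasure N B"
    using Vitali_covering_open[OF U(1,2), of "\<lambda>B. emeasure M B \<le> emeasure N B"] fine by metis
  have B: "\<B> \<subseteq> sets borel" "\<Union>\<B> \<in> sets borel" using le \<B>(1) by (auto intro: sets.countable_Union)
  have "E - \<Union>\<B> \<in> null_sets lborel"
    using null B(2) E by (simp add: negligible_iff_null_sets null_sets_completion_iff)
  then have "emeasure M (E - \<Union>\<B>) = 0"
    using ac by (auto simp: absolutely_continuous_def null_sets_def)
  then have "emeasure M E \<le> emeasure M (\<Union>\<B>)"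
    using emeasure_subadditive[of "\<Union>\<B>" M "E - \<Union>\<B>"] emeasure_mono[of E "\<Union>\<B> \<union> (E - \<Union>\<B>)" M] B(2) E sets
    by (auto intro: order_trans)
  also have "\<dots> \<le> emeasure N (\<Union>\<B>)"
    by (rule emeasure_Union_mono[OF \<B>(1,2)]) (use B(1) sets le in auto)
  also have "\<dots> \<le> emeasure N (E \<union> (U - E))"
    using \<B>(3) U(1) E sets(2) by (intro emeasure_mono) auto
  also have "\<dots> \<le> emeasure N E + emeasure N (U - E)"
    using U(1) E sets(2) by (intro emeasure_subadditive) auto
  also have "\<dots> \<le> emeasure N E + ennreal e" using U(3) by (intro add_left_mono)
  finally show "emeasure M E \<le> emeasure N E + ennreal e" .
qed

lemma outer_open_of_le_lborel:
  fixes N :: "'n::euclidean_space measure"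
  assumes le: "\<And>S. S \<in> sets borel \<Longrightarrow> emeasure N S \<le> ennreal C * emeasure lborel S"
    and E: "E \<in> sets borel" and "0 < e"
  shows "\<exists>U. open U \<and> E \<subseteq> U \<and> emeasure N (U - E) \<le> ennreal e"
proof -
  define \<delta> where "\<delta> = e / (1 + \<bar>C\<bar>)"
  have \<delta>: "0 < \<delta>" using \<open>0 < e\<close> by (simp add: \<delta>_def)
  have "E \<in> sets lebesgue" using E by simp
  then obtain U where U: "open U" "E \<subseteq> U" "emeasure lebesgue (U - E) < ennreal \<delta>"
    using sets_lebesgue_outer_open[OF _ \<delta>] by blast
  have S: "U - E \<in> sets borel" using U(1) E by auto
  have "emeasure N (U - E) \<le> ennreal C * emeasure lborel (U - E)" by (rule le[OF S])
  also have "\<dots> \<le> ennreal \<bar>C\<bar> * ennreal \<delta>" using U(3) S by (intro mult_mono ennreal_leI) auto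
  also have "\<dots> \<le> ennreal e"
    using \<open>0 < e\<close>
    by (subst ennreal_mult[symmetric]) (auto simp: \<delta>_def field_simps intro!: ennreal_leI)
  finally show ?thesis using U(1,2) by blast
qed

section \<open>Almost everywhere differentiability of Lipschitz functions\<close>

lemma frequently_at_0_iff:
  "(\<exists>\<^sub>F h in at (0::real). P h) \<longleftrightarrow> (\<forall>d>0. \<exists>h. h \<noteq> 0 \<and> \<bar>h\<bar> < d \<and> P h)"
  unfolding frequently_def eventually_at by (auto simp: dist_real_def)

definition difference_quotient :: "(real \<Rightarrow> real) \<Rightarrow> real \<Rightarrow> real \<Rightarrow> real"
  where "difference_quotient f x h = (f (x + h) - f x) / h"

lemma difference_quotient_minus: "difference_quotient (\<lambda>x. - f x) x h = - difference_quotient f x h"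
  unfolding difference_quotient_def by (simp add: minus_divide_left)

lemma difference_quotient_linear: "h \<noteq> 0 \<Longrightarrow> difference_quotient (\<lambda>x. c * x) x h = c"
  by (simp add: difference_quotient_def distrib_left)

lemma has_real_derivative_iff_difference_quotient:
  "(f has_real_derivative D) (at x) \<longleftrightarrow> (difference_quotient f x \<longlongrightarrow> D) (at 0)"
  unfolding DERIV_def difference_quotient_def ..

lemma borel_frequently_quotient_less:
  fixes f :: "real \<Rightarrow> real"
  assumes "continuous_on UNIV f"
  shows "{x. \<exists>\<^sub>F h in at 0. difference_quotient f x h < r} \<in> sets borel"
proof -
  let ?V = "\<lambda>n::nat. \<Union>h\<in>{h. h \<noteq> 0 \<and> \<bar>h\<bar> < inverse (Suc n)}. {x. difference_quotient f x h < r}"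
  have "(\<exists>\<^sub>F h in at 0. difference_quotient f x h < r) \<longleftrightarrow> (\<forall>n. x \<in> ?V n)" for x
  proof
    assume V: "\<forall>n. x \<in> ?V n"
    show "\<exists>\<^sub>F h in at 0. difference_quotient f x h < r"
      unfolding frequently_at_0_iff
    proof (intro allI impI)
      fix d :: real assume "0 < d"
      then obtain n where n: "inverse (real (Suc n)) < d" using reals_Archimedean by auto
      obtain h where "h \<noteq> 0" "\<bar>h\<bar> < inverse (real (Suc n))" "difference_quotient f x h < r"
        using V by blast
      with n show "\<exists>h. h \<noteq> 0 \<and> \<bar>h\<bar> < d \<and> difference_quotient f x h < r"
        by (intro exI[of _ h]) linarith
    qed
  qed (simp add: frequently_at_0_iff)
  then have "{x. \<exists>\<^sub>F h in at 0. difference_quotient f x h < r} = (\<Inter>n. ?V n)" by blast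
  moreover have "open {x. difference_quotient f x h < r}" if "h \<noteq> 0" for h
    unfolding difference_quotient_def
    using that by (intro open_Collect_less continuous_intros continuous_on_compose2[OF assms]) auto
  then have "open (?V n)" for n by blast
  ultimately show ?thesis by (auto intro: borel_open)
qed

lemma borel_frequently_quotient_greater:
  fixes f :: "real \<Rightarrow> real"
  assumes "continuous_on UNIV f"
  shows "{x. \<exists>\<^sub>F h in at 0. r < difference_quotient f x h} \<in> sets borel"
  using borel_frequently_quotient_less[of "\<lambda>x. - f x" "- r"] assms
  by (simp add: continuous_on_minus difference_quotient_minus)

lemma tendsto_if_no_oscillation:
  fixes f :: "'a \<Rightarrow> real"
  assumes F: "F \<noteq> bot" and bounds: "\<forall>\<^sub>F x in F. a \<le> f x" "\<forall>\<^sub>F x in F. f x \<le> b"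
    and osc: "\<And>r s. r \<in> \<rat> \<Longrightarrow> s \<in> \<rat> \<Longrightarrow> r < s \<Longrightarrow> \<not> ((\<exists>\<^sub>F x in F. f x < r) \<and> (\<exists>\<^sub>F x in F. s < f x))"
  shows "\<exists>l. (f \<longlongrightarrow> l) F"
proof -
  let ?f = "\<lambda>x. ereal (f x)"
  have le: "Liminf F ?f \<le> Limsup F ?f" by (rule Liminf_le_Limsup[OF F])
  have "Limsup F ?f \<le> Liminf F ?f"
  proof (rule ccontr)
    assume "\<not> ?thesis"
    then obtain r where r: "Liminf F ?f < ereal (real_of_rat r)" "ereal (real_of_rat r) < Limsup F ?f"
      using ereal_dense3 by (metis not_le)
    then obtain s where s: "real_of_rat r < real_of_rat s" "ereal (real_of_rat s) < Limsup F ?f"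
      using ereal_dense3 ereal_less_le less_ereal.simps(1) by metis
    have "\<exists>\<^sub>F x in F. f x < real_of_rat r"
      using Liminf_bounded[of "ereal (real_of_rat r)" ?f F] r(1)
      by (force simp: frequently_def not_less)
    moreover have "\<exists>\<^sub>F x in F. real_of_rat s < f x"
      using Limsup_bounded[of ?f "ereal (real_of_rat s)" F] s(2)
      by (force simp: frequently_def not_less)
    ultimately show False using osc[OF _ _ s(1)] by simp
  qed
  with le have eq: "Liminf F ?f = Limsup F ?f" by simp
  have "ereal a \<le> Liminf F ?f" "Limsup F ?f \<le> ereal b"
    using bounds by (auto intro!: Liminf_bounded Limsup_bounded)
  then obtain l where l: "Limsup F ?f = ereal l" using eq by (cases "Limsup F ?f") auto
  then have "(?f \<longlongrightarrow> ereal l) F" using Liminf_eq_Limsup[OF F] eq by metis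
  then show ?thesis by auto
qed

locale mono_lipschitz =
  fixes f :: "real \<Rightarrow> real" and L :: real
  assumes mono: "mono f" and lipschitz: "L-lipschitz_on UNIV f"
begin

lemma L_nonneg: "0 \<le> L"
  by (rule lipschitz_on_nonneg[OF lipschitz])

lemma continuous: "continuous_on UNIV f"
  by (rule lipschitz_on_continuous_on[OF lipschitz])

lemma continuous_at_right: "continuous (at_right a) f"
  using continuous
  by (simp add: continuous_on_eq_continuous_within continuous_at_imp_continuous_at_within)

lemma increment_bounds:
  assumes "x \<le> y"
  shows "0 \<le> f y - f x" "f y - f x \<le> L * (y - x)"
  using monoD[OF mono assms] lipschitz_onD[OF lipschitz, of y x] assms by (auto simp: dist_real_def)

lemma difference_quotient_nonneg: "h \<noteq> 0 \<Longrightarrow> 0 \<le> difference_quotient f x h"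
  using increment_bounds[of x "x + h"] increment_bounds[of "x + h" x] unfolding difference_quotient_def
  by (auto simp: zero_le_divide_iff neq_iff)

lemma difference_quotient_le: "h \<noteq> 0 \<Longrightarrow> difference_quotient f x h \<le> L"
  using increment_bounds[of x "x + h"] increment_bounds[of "x + h" x] unfolding difference_quotient_def
  by (cases "0 < h") (auto simp: field_simps)

lemma emeasure_interval_measure_le:
  assumes "S \<in> sets borel"
  shows "emeasure (interval_measure f) S \<le> ennreal L * emeasure lborel S"
proof -
  let ?g = "\<lambda>x. L * x - f x"
  have "mono ?g"
    using increment_bounds by (intro monoI) (fastforce simp: algebra_simps)
  moreover have "continuous (at_right a) ?g" for a
    by (intro continuous_intros continuous_at_right)
  ultimately have "interval_measure (\<lambda>x. L * x) = sum_measure (interval_measure f) (interval_measure ?g)"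
    using interval_measure_add[of f ?g] mono continuous_at_right by simp
  then have "ennreal L * emeasure lborel S =
      emeasure (interval_measure f) S + emeasure (interval_measure ?g) S"
    using assms L_nonneg emeasure_sum_measure[of "interval_measure ?g" "interval_measure f" S]
    by (simp add: interval_measure_cmult flip: emeasure_scale_measure)
  then show ?thesis by simp
qed

lemma absolutely_continuous_interval_measure: "absolutely_continuous lborel (interval_measure f)"
  unfolding absolutely_continuous_def
proof
  fix S :: "real set" assume "S \<in> null_sets lborel"
  then show "S \<in> null_sets (interval_measure f)"
    using emeasure_interval_measure_le[of S] by (auto simp: null_sets_def)
qed

lemma emeasure_quotient_cball:
  assumes "h \<noteq> 0"
  shows "emeasure (interval_measure f) (cball (x + h / 2) (\<bar>h\<bar> / 2)) =
    ennreal (difference_quotient f x h * \<bar>h\<bar>)"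
proof -
  have "cball (x + h / 2) (\<bar>h\<bar> / 2) = (if 0 < h then {x..x + h} else {x + h..x})"
    by (auto simp: cball_eq_atLeastAtMost field_simps abs_if)
  then show ?thesis
    using assms mono continuous
    by (auto simp: emeasure_interval_measure_Icc monoD difference_quotient_def)
qed

lemma emeasure_le_of_frequently_quotient:
  fixes g :: "real \<Rightarrow> real"
  assumes g: "mono_lipschitz g K" and E: "E \<in> sets borel"
    and quotient: "\<And>x. x \<in> E \<Longrightarrow> \<exists>\<^sub>F h in at 0. difference_quotient f x h \<le> difference_quotient g x h"
  shows "emeasure (interval_measure f) E \<le> emeasure (interval_measure g) E"
proof (rule emeasure_le_of_fine_cballs[OF _ _ E absolutely_continuous_interval_measure])
  interpret g: mono_lipschitz g K by (rule g)
  show "\<exists>U. open U \<and> E \<subseteq> U \<and> emeasure (interval_measure g) (U - E) \<le> ennreal e" if "0 < e" for e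
    using outer_open_of_le_lborel[OF g.emeasure_interval_measure_le E that] .
  fix x d :: real assume "x \<in> E" "0 < d"
  then obtain h where h: "h \<noteq> 0" "\<bar>h\<bar> < d" "difference_quotient f x h \<le> difference_quotient g x h"
    using quotient unfolding frequently_at_0_iff by blast
  then have "emeasure (interval_measure f) (cball (x + h / 2) (\<bar>h\<bar> / 2)) \<le>
      emeasure (interval_measure g) (cball (x + h / 2) (\<bar>h\<bar> / 2))"
    unfolding emeasure_quotient_cball[OF h(1)] g.emeasure_quotient_cball[OF h(1)]
    by (intro ennreal_leI mult_right_mono) auto
  moreover have "x \<in> cball (x + h / 2) (\<bar>h\<bar> / 2)" by (simp add: dist_real_def)
  ultimately show "\<exists>c r. 0 < r \<and> r < d \<and> x \<in> cball c r \<and>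
      emeasure (interval_measure f) (cball c r) \<le> emeasure (interval_measure g) (cball c r)"
    using h(1,2) by (intro exI[of _ "x + h / 2"] exI[of _ "\<bar>h\<bar> / 2"]) auto
qed auto

end

lemma mono_lipschitz_cmult: "0 \<le> c \<Longrightarrow> mono_lipschitz (\<lambda>x. c * x) c"
  by unfold_locales
    (auto intro!: monoI mult_left_mono lipschitz_onI simp: dist_real_def abs_mult simp flip: right_diff_distrib)

context mono_lipschitz
begin

lemma emeasure_le_of_small_quotients:
  assumes "0 \<le> r" "E \<in> sets borel" "\<And>x. x \<in> E \<Longrightarrow> \<exists>\<^sub>F h in at 0. difference_quotient f x h < r"
  shows "emeasure (interval_measure f) E \<le> ennreal r * emeasure lborel E"
proof -
  have "emeasure (interval_measure f) E \<le> emeasure (interval_measure (\<lambda>x. r * x)) E"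
  proof (rule emeasure_le_of_frequently_quotient[OF mono_lipschitz_cmult[OF assms(1)] assms(2)])
    fix x assume "x \<in> E"
    then show "\<exists>\<^sub>F h in at 0. difference_quotient f x h \<le> difference_quotient (\<lambda>x. r * x) x h"
      using assms(3) unfolding frequently_at_0_iff by (metis difference_quotient_linear less_imp_le)
  qed
  then show ?thesis using assms(1) by (simp add: interval_measure_cmult)
qed

lemma emeasure_ge_of_large_quotients:
  assumes "0 \<le> s" "E \<in> sets borel" "\<And>x. x \<in> E \<Longrightarrow> \<exists>\<^sub>F h in at 0. s < difference_quotient f x h"
  shows "ennreal s * emeasure lborel E \<le> emeasure (interval_measure f) E"
proof -
  interpret linear: mono_lipschitz "\<lambda>x. s * x" s by (rule mono_lipschitz_cmult[OF assms(1)])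
  have "emeasure (interval_measure (\<lambda>x. s * x)) E \<le> emeasure (interval_measure f) E"
  proof (rule linear.emeasure_le_of_frequently_quotient[OF mono_lipschitz_axioms assms(2)])
    fix x assume "x \<in> E"
    then show "\<exists>\<^sub>F h in at 0. difference_quotient (\<lambda>x. s * x) x h \<le> difference_quotient f x h"
      using assms(3) unfolding frequently_at_0_iff by (metis difference_quotient_linear less_imp_le)
  qed
  then show ?thesis using assms(1) by (simp add: interval_measure_cmult)
qed

lemma null_sets_of_oscillation:
  assumes "0 \<le> r" "r < s" and E: "E \<in> sets borel" "emeasure lborel E \<noteq> \<infinity>"
    and osc: "\<And>x. x \<in> E \<Longrightarrow>
      (\<exists>\<^sub>F h in at 0. difference_quotient f x h < r) \<and> (\<exists>\<^sub>F h in at 0. s < difference_quotient f x h)"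
  shows "E \<in> null_sets lborel"
proof -
  obtain z where z: "emeasure lborel E = ennreal z" "0 \<le> z"
    using E(2) by (cases "emeasure lborel E") auto
  have "ennreal s * emeasure lborel E \<le> emeasure (interval_measure f) E"
    by (rule emeasure_ge_of_large_quotients) (use assms in auto)
  also have "\<dots> \<le> ennreal r * emeasure lborel E"
    by (rule emeasure_le_of_small_quotients) (use assms in auto)
  finally have "s * z \<le> r * z" using z assms(1,2) by (simp add: ennreal_mult[symmetric])
  then have "z = 0" using z(2) assms(2) by (simp add: mult_le_cancel_right)
  then show ?thesis using E(1) z by (simp add: null_sets_def)
qed

lemma AE_no_oscillation:
  assumes "r < s"
  shows "AE x in lborel.
    \<not> ((\<exists>\<^sub>F h in at 0. difference_quotient f x h < r) \<and> (\<exists>\<^sub>F h in at 0. s < difference_quotient f x h))"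
proof (cases "0 \<le> r")
  case False
  then have "\<not> difference_quotient f x h < r" if "h \<noteq> 0" for x h
    using difference_quotient_nonneg[OF that, of x] by linarith
  then have "\<not> (\<exists>\<^sub>F h in at 0. difference_quotient f x h < r)" for x
    unfolding frequently_at_0_iff using zero_less_one by blast
  then show ?thesis by simp
next
  case True
  define E where "E n = {x. \<exists>\<^sub>F h in at 0. difference_quotient f x h < r} \<inter>
    {x. \<exists>\<^sub>F h in at 0. s < difference_quotient f x h} \<inter> {- real n..real n}" for n
  have "E n \<in> null_sets lborel" for n
  proof (rule null_sets_of_oscillation[OF True assms])
    show "E n \<in> sets borel"
      unfolding E_def using continuous
      by (intro sets.Int borel_frequently_quotient_less borel_frequently_quotient_greater) auto
    have "emeasure lborel (E n) \<le> emeasure lborel {- real n..real n}"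
      by (intro emeasure_mono) (auto simp: E_def)
    then show "emeasure lborel (E n) \<noteq> \<infinity>" by (auto simp: top_unique)
  qed (simp add: E_def)
  moreover have "\<exists>n. x \<in> {- real n..real n}" for x
    using real_arch_simple[of "\<bar>x\<bar>"] by (simp add: abs_le_iff minus_le_iff conj_commute)
  ultimately show ?thesis
    by (intro AE_I'[OF null_sets_UN[of E]]) (auto simp: E_def)
qed

lemma AE_differentiable: "AE x in lborel. \<exists>D. (f has_real_derivative D) (at x)"
proof -
  have "AE x in lborel. \<forall>r\<in>\<rat>. \<forall>s\<in>\<rat>. r < s \<longrightarrow>
      \<not> ((\<exists>\<^sub>F h in at 0. difference_quotient f x h < r) \<and> (\<exists>\<^sub>F h in at 0. s < difference_quotient f x h))"
    using AE_no_oscillation by (simp add: AE_ball_countable countable_rat)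
  then show ?thesis
  proof eventually_elim
    case (elim x)
    have "\<forall>\<^sub>F h in at 0. 0 \<le> difference_quotient f x h" "\<forall>\<^sub>F h in at 0. difference_quotient f x h \<le> L"
      using difference_quotient_nonneg difference_quotient_le
      by (auto simp: eventually_at intro!: exI[of _ 1])
    then show ?case
      unfolding has_real_derivative_iff_difference_quotient
      using elim by (intro tendsto_if_no_oscillation) auto
  qed
qed

lemma increment_le_of_small_quotients:
  assumes "a \<le> b" "0 \<le> r"
    and quotient: "AE x in lborel. a < x \<longrightarrow> x < b \<longrightarrow> (\<exists>\<^sub>F h in at 0. difference_quotient f x h < r)"
  shows "f b - f a \<le> r * (b - a)"
proof -
  define E where "E = {a..b} \<inter> {x. \<exists>\<^sub>F h in at 0. difference_quotient f x h < r}"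
  have E: "E \<in> sets borel"
    unfolding E_def by (intro sets.Int borel_frequently_quotient_less continuous) simp
  have "AE x in lborel. x \<in> {a..b} \<longrightarrow> x \<in> E"
    using quotient AE_lborel_singleton[of a] AE_lborel_singleton[of b]
    by eventually_elim (auto simp: E_def)
  then have "AE x in interval_measure f. x \<in> {a..b} \<longrightarrow> x \<in> E"
    by (rule absolutely_continuous_AE[OF _ absolutely_continuous_interval_measure, rotated]) simp
  then have "emeasure (interval_measure f) {a..b} \<le> emeasure (interval_measure f) E"
    using E by (intro emeasure_mono_AE) auto
  also have "\<dots> \<le> ennreal r * emeasure lborel E"
    using E \<open>0 \<le> r\<close> by (intro emeasure_le_of_small_quotients) (auto simp: E_def)
  also have "\<dots> \<le> ennreal r * emeasure lborel {a..b}"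
    by (intro mult_left_mono emeasure_mono) (auto simp: E_def)
  also have "\<dots> = ennreal (r * (b - a))" using assms(1,2) by (simp add: ennreal_mult)
  finally show ?thesis
    using assms(1,2) mono continuous by (simp add: emeasure_interval_measure_Icc monoD)
qed

lemma increment_le:
  assumes "a < b" "0 \<le> r"
    and deriv: "AE x in lborel. a < x \<longrightarrow> x < b \<longrightarrow> (\<forall>D. (f has_real_derivative D) (at x) \<longrightarrow> D \<le> r)"
  shows "f b - f a \<le> r * (b - a)"
proof -
  have "(f b - f a) / (b - a) \<le> r"
  proof (rule dense_ge)
    fix s assume "r < s"
    have "AE x in lborel. a < x \<longrightarrow> x < b \<longrightarrow> (\<exists>\<^sub>F h in at 0. difference_quotient f x h < s)"
      using deriv AE_differentiable
    proof eventually_elim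
      case (elim x)
      show ?case
      proof (intro impI)
        assume "a < x" "x < b"
        with elim obtain D where "(f has_real_derivative D) (at x)" "D < s" using \<open>r < s\<close> by force
        then have "\<forall>\<^sub>F h in at 0. difference_quotient f x h < s"
          unfolding has_real_derivative_iff_difference_quotient by (rule order_tendstoD)
        then show "\<exists>\<^sub>F h in at 0. difference_quotient f x h < s"
          by (simp add: eventually_frequently)
      qed
    qed
    then have "f b - f a \<le> s * (b - a)"
      using assms(1,2) \<open>r < s\<close> by (intro increment_le_of_small_quotients) auto
    then show "(f b - f a) / (b - a) \<le> s" using assms(1) by (simp add: pos_divide_le_eq)
  qed
  then show ?thesis using assms(1) by (simp add: pos_divide_le_eq)
qed

end

lemma mono_lipschitz_add_linear:
  fixes f :: "real \<Rightarrow> real"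
  assumes "L-lipschitz_on UNIV f"
  shows "mono_lipschitz (\<lambda>x. f x + L * x) (L + L)"
proof
  show "mono (\<lambda>x. f x + L * x)"
  proof (rule monoI)
    fix x y :: real assume "x \<le> y"
    then have "f x - f y \<le> L * (y - x)"
      using lipschitz_onD[OF assms, of x y] by (auto simp: dist_real_def)
    then show "f x + L * x \<le> f y + L * y" by (simp add: algebra_simps)
  qed
  have "L-lipschitz_on UNIV (\<lambda>x. L * x)"
    using lipschitz_on_nonneg[OF assms] mono_lipschitz.lipschitz[OF mono_lipschitz_cmult] by blast
  then show "(L + L)-lipschitz_on UNIV (\<lambda>x. f x + L * x)" by (intro lipschitz_on_add assms)
qed

lemma has_real_derivative_add_linear_iff:
  "((\<lambda>x. f x + L * x) has_real_derivative D + L) (at x) \<longleftrightarrow> (f has_real_derivative D) (at x)"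
proof
  assume "((\<lambda>x. f x + L * x) has_real_derivative D + L) (at x)"
  from DERIV_diff[OF this DERIV_cmult[OF DERIV_ident, of L]]
  show "(f has_real_derivative D) (at x)" by simp
next
  assume "(f has_real_derivative D) (at x)"
  from DERIV_add[OF this DERIV_cmult[OF DERIV_ident, of L]]
  show "((\<lambda>x. f x + L * x) has_real_derivative D + L) (at x)" by simp
qed

lemma lipschitz_AE_differentiable:
  fixes f :: "real \<Rightarrow> real"
  assumes "L-lipschitz_on UNIV f"
  shows "AE x in lborel. \<exists>D. (f has_real_derivative D) (at x)"
  using mono_lipschitz.AE_differentiable[OF mono_lipschitz_add_linear[OF assms]]
proof eventually_elim
  case (elim x)
  then obtain D where "((\<lambda>x. f x + L * x) has_real_derivative (D - L) + L) (at x)" by auto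
  then show ?case unfolding has_real_derivative_add_linear_iff by blast
qed

lemma lipschitz_increment_le:
  fixes f :: "real \<Rightarrow> real"
  assumes lip: "L-lipschitz_on UNIV f" and "a < b"
    and deriv: "AE x in lborel. a < x \<longrightarrow> x < b \<longrightarrow> (\<forall>D. (f has_real_derivative D) (at x) \<longrightarrow> D \<le> r)"
  shows "f b - f a \<le> r * (b - a)"
proof -
  define K where "K = L + \<bar>r\<bar>"
  have K: "K-lipschitz_on UNIV f" by (rule lipschitz_on_mono[OF lip]) (simp_all add: K_def)
  interpret mono_lipschitz "\<lambda>x. f x + K * x" "K + K" by (rule mono_lipschitz_add_linear[OF K])
  have "f b + K * b - (f a + K * a) \<le> (r + K) * (b - a)"
  proof (rule increment_le[OF \<open>a < b\<close>])
    show "0 \<le> r + K" using lipschitz_on_nonneg[OF lip] by (simp add: K_def)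
    show "AE x in lborel. a < x \<longrightarrow> x < b \<longrightarrow>
        (\<forall>D. ((\<lambda>x. f x + K * x) has_real_derivative D) (at x) \<longrightarrow> D \<le> r + K)"
      using deriv
    proof eventually_elim
      case (elim x)
      show ?case
        using elim has_real_derivative_add_linear_iff[of f K "D - K" x for D] by fastforce
    qed
  qed
  then show ?thesis by (simp add: algebra_simps)
qed

section \<open>Nonnegative functions with negative drift\<close>

lemma lipschitz_on_max_const:
  fixes f :: "'a::metric_space \<Rightarrow> real"
  assumes "L-lipschitz_on S f"
  shows "L-lipschitz_on S (\<lambda>x. max c (f x))"
proof (rule lipschitz_onI)
  fix x y assume "x \<in> S" "y \<in> S"
  then have "dist (f x) (f y) \<le> L * dist x y" by (rule lipschitz_onD[OF assms])
  then show "dist (max c (f x)) (max c (f y)) \<le> L * dist x y" by (auto simp: dist_real_def)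
qed (rule lipschitz_on_nonneg[OF assms])

lemma lipschitz_on_extend_halfline:
  fixes f :: "real \<Rightarrow> 'a::metric_space"
  assumes "L-lipschitz_on {0..} f"
  shows "L-lipschitz_on UNIV (\<lambda>t. f (max 0 t))"
proof -
  have "L-lipschitz_on (range (max 0)) f" by (rule lipschitz_on_subset[OF assms]) auto
  from lipschitz_on_compose2[OF lipschitz_on_max_const[OF lipschitz_on_id] this] show ?thesis
    by simp
qed

lemma has_real_derivative_extend_halfline_iff:
  fixes f :: "real \<Rightarrow> real"
  assumes "0 < t"
  shows "((\<lambda>t. f (max 0 t)) has_real_derivative D) (at t) \<longleftrightarrow> (f has_real_derivative D) (at t)"
proof (rule has_field_derivative_cong_ev)
  show "\<forall>\<^sub>F x in nhds t. x \<in> UNIV \<longrightarrow> f (max 0 x) = f x"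
    using eventually_nhds_in_open[of "{0<..}" t] assms by (auto elim: eventually_mono)
qed (use assms in auto)

lemma lipschitz_halfline_AE_differentiable:
  fixes f :: "real \<Rightarrow> real"
  assumes "L-lipschitz_on {0..} f"
  shows "AE t in lborel. 0 < t \<longrightarrow> (\<exists>D. (f has_real_derivative D) (at t))"
  using lipschitz_AE_differentiable[OF lipschitz_on_extend_halfline[OF assms]]
  by eventually_elim (use has_real_derivative_extend_halfline_iff in blast)

lemma lipschitz_halfline_increment_le:
  fixes f :: "real \<Rightarrow> real"
  assumes lip: "L-lipschitz_on {0..} f" and ab: "0 \<le> a" "a < b"
    and deriv: "AE t in lborel. a < t \<longrightarrow> t < b \<longrightarrow> (\<exists>D. (f has_real_derivative D) (at t) \<and> D \<le> r)"
  shows "f b - f a \<le> r * (b - a)"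
proof -
  have "f (max 0 b) - f (max 0 a) \<le> r * (b - a)"
  proof (rule lipschitz_increment_le[OF lipschitz_on_extend_halfline[OF lip] ab(2)])
    show "AE t in lborel. a < t \<longrightarrow> t < b \<longrightarrow>
        (\<forall>D. ((\<lambda>t. f (max 0 t)) has_real_derivative D) (at t) \<longrightarrow> D \<le> r)"
      using deriv
    proof eventually_elim
      case (elim t)
      then show ?case
        using ab has_real_derivative_extend_halfline_iff[of t f] DERIV_unique[of f _ t] by fastforce
    qed
  qed
  then show ?thesis using ab by simp
qed

lemma DERIV_zero_at_halfline_min:
  fixes f :: "real \<Rightarrow> real"
  assumes "(f has_real_derivative D) (at t)" "0 < t" "f t = 0" "\<And>s. 0 \<le> s \<Longrightarrow> 0 \<le> f s"
  shows "D = 0"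
  using assms by (intro DERIV_local_min[OF assms(1) assms(2)]) (auto simp: abs_less_iff)

text \<open>At a zero of \<open>f\<close> the derivative vanishes, so \<open>f\<close> cannot grow anywhere.\<close>

lemma lipschitz_nonneg_decreasing:
  fixes f :: "real \<Rightarrow> real"
  assumes lip: "L-lipschitz_on {0..} f" and nonneg: "\<And>t. 0 \<le> t \<Longrightarrow> 0 \<le> f t" and "0 \<le> a" "a < b"
    and drift: "AE t in lborel. a < t \<longrightarrow> 0 < f t \<longrightarrow> (\<exists>D. (f has_real_derivative D) (at t) \<and> D \<le> 0)"
  shows "f b \<le> f a"
proof -
  have "AE t in lborel. a < t \<longrightarrow> t < b \<longrightarrow> (\<exists>D. (f has_real_derivative D) (at t) \<and> D \<le> 0)"
    using drift lipschitz_halfline_AE_differentiable[OF lip]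
  proof eventually_elim
    case (elim t)
    show ?case
    proof (intro impI)
      assume "a < t"
      then have t: "0 < t" using \<open>0 \<le> a\<close> by simp
      then obtain D where D: "(f has_real_derivative D) (at t)" using elim by blast
      show "\<exists>D. (f has_real_derivative D) (at t) \<and> D \<le> 0"
      proof (cases "0 < f t")
        case True
        then show ?thesis using elim \<open>a < t\<close> by blast
      next
        case False
        then have "f t = 0" using nonneg[of t] t by simp
        then show ?thesis using DERIV_zero_at_halfline_min[OF D t _ nonneg] D by blast
      qed
    qed
  qed
  from lipschitz_halfline_increment_le[OF lip \<open>0 \<le> a\<close> \<open>a < b\<close> this] show ?thesis by simp
qed

lemma eventually_zero_of_negative_drift:
  fixes f :: "real \<Rightarrow> real"
  assumes lip: "L-lipschitz_on {0..} f" and nonneg: "\<And>t. 0 \<le> t \<Longrightarrow> 0 \<le> f t" and "0 \<le> a" "0 < c"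
    and drift: "AE t in lborel. a < t \<longrightarrow> 0 < f t \<longrightarrow> (\<exists>D. (f has_real_derivative D) (at t) \<and> D \<le> - c)"
  shows "\<forall>\<^sub>F t in at_top. f t = 0"
proof -
  have decreasing: "f y \<le> f x" if "a \<le> x" "x < y" for x y
  proof (rule lipschitz_nonneg_decreasing[OF lip nonneg])
    show "AE t in lborel. x < t \<longrightarrow> 0 < f t \<longrightarrow> (\<exists>D. (f has_real_derivative D) (at t) \<and> D \<le> 0)"
      using drift by eventually_elim (use that \<open>0 < c\<close> in fastforce)
  qed (use that \<open>0 \<le> a\<close> in auto)
  have "f t = 0" if t: "a + f a / c + 1 \<le> t" for t
  proof (rule ccontr)
    assume "f t \<noteq> 0"
    have "0 \<le> f a / c" using nonneg[of a] \<open>0 \<le> a\<close> \<open>0 < c\<close> by simp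
    then have "a < t" using t by linarith
    then have pos: "0 < f t" using nonneg[of t] \<open>f t \<noteq> 0\<close> \<open>0 \<le> a\<close> by simp
    have "AE r in lborel. a < r \<longrightarrow> r < t \<longrightarrow> (\<exists>D. (f has_real_derivative D) (at r) \<and> D \<le> - c)"
      using drift
      by eventually_elim (use decreasing[of _ t] pos in \<open>meson less_le_trans order_less_imp_le\<close>)
    then have "f t - f a \<le> - c * (t - a)"
      by (rule lipschitz_halfline_increment_le[OF lip \<open>0 \<le> a\<close> \<open>a < t\<close>])
    moreover have "f a < c * (t - a)" using t \<open>0 < c\<close> by (simp add: field_simps)
    ultimately show False using pos by simp
  qed
  then show ?thesis unfolding eventually_at_top_linorder by blast
qed

section \<open>Stations serving two classes\<close>

text \<open>
  \<open>q k\<close> is the share of its station's workload that the ratio matrix assigns to class \<open>k\<close>, and \<open>a d k\<close>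
  is the arrival rate into class \<open>k\<close> when the classes are served at the rates \<open>d\<close>.
\<close>

locale two_class_stations =
  fixes sib :: "'k::finite \<Rightarrow> 'k" and m q :: "'k \<Rightarrow> real" and a :: "('k \<Rightarrow> real) \<Rightarrow> 'k \<Rightarrow> real"
  assumes sib_sib [simp]: "sib (sib k) = k"
    and service_time_pos: "0 < m k"
    and share_nonneg: "0 \<le> q k"
    and share_add: "q k + q (sib k) = 1"
begin

text \<open>
  The last implication describes a station without overload: its queues keep the prescribed ratio,
  and it works at full capacity unless it is empty.
\<close>

definition service_rates :: "('k \<Rightarrow> real) \<Rightarrow> ('k \<Rightarrow> real) \<Rightarrow> bool" where
  "service_rates y d \<longleftrightarrow> (\<forall>k. 0 \<le> d k \<and> m k * d k + m (sib k) * d (sib k) \<le> 1 \<and>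
    (0 < y k \<longrightarrow> m k * d k = 1) \<and>
    (y k \<le> 0 \<longrightarrow> y (sib k) \<le> 0 \<longrightarrow>
      q (sib k) * (m k * (a d k - d k)) = q k * (m (sib k) * (a d (sib k) - d (sib k))) \<and>
      (m k * d k + m (sib k) * d (sib k) = 1 \<or> d k = a d k)))"

definition drift :: "('k \<Rightarrow> real) \<Rightarrow> ('k \<Rightarrow> real) \<Rightarrow> 'k \<Rightarrow> real" where
  "drift y d k = (if 0 < y k then m k * a d k - 1 else 0)"

lemma service_rate_nonneg: "service_rates y d \<Longrightarrow> 0 \<le> d k"
  by (simp add: service_rates_def)

lemma service_capacity: "service_rates y d \<Longrightarrow> m k * d k + m (sib k) * d (sib k) \<le> 1"
  by (simp add: service_rates_def)

lemma overloaded_service_rate: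
  assumes "service_rates y d" "0 < y k"
  shows "d k = 1 / m k" "d (sib k) = 0"
proof -
  have full: "m k * d k = 1" using assms by (simp add: service_rates_def)
  then show "d k = 1 / m k" using service_time_pos[of k] by (simp add: field_simps)
  have "m (sib k) * d (sib k) \<le> 0" using service_capacity[OF assms(1), of k] full by simp
  then show "d (sib k) = 0"
    using service_time_pos[of "sib k"] service_rate_nonneg[OF assms(1), of "sib k"]
    by (simp add: mult_le_0_iff)
qed

lemma sib_not_overloaded:
  assumes "service_rates y d" "0 < y k"
  shows "y (sib k) \<le> 0"
proof (rule ccontr)
  assume "\<not> ?thesis"
  then show False
    using overloaded_service_rate[OF assms] overloaded_service_rate(2)[OF assms(1), of "sib k"]
      service_time_pos[of k]
    by simp
qed

lemma service_rate_le_inverse: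
  assumes "service_rates y d"
  shows "d k \<le> 1 / m k"
proof -
  have "0 \<le> m (sib k) * d (sib k)"
    using service_time_pos[of "sib k"] service_rate_nonneg[OF assms] by simp
  then have "m k * d k \<le> 1" using service_capacity[OF assms, of k] by linarith
  then show ?thesis using service_time_pos[of k] by (simp add: field_simps)
qed

lemma service_rate_without_overload:
  assumes "service_rates y d" "y k \<le> 0" "y (sib k) \<le> 0"
  shows "d k = a d k \<or> m k * d k = q (sib k) * (m k * a d k) + q k * (1 - m (sib k) * a d (sib k))"
proof (cases "d k = a d k")
  case False
  then have full: "m (sib k) * d (sib k) = 1 - m k * d k"
    and ratio: "q (sib k) * (m k * (a d k - d k)) = q k * (m (sib k) * (a d (sib k) - d (sib k)))"
    using assms unfolding service_rates_def by force+
  have "q (sib k) * (m k * a d k) + q k * (1 - m (sib k) * a d (sib k)) =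
      q (sib k) * (m k * (a d k - d k)) - q k * (m (sib k) * a d (sib k) - m (sib k) * d (sib k))
      + (q k + q (sib k)) * (m k * d k)"
    unfolding full by (simp add: algebra_simps)
  also have "\<dots> = m k * d k" using ratio by (simp add: share_add right_diff_distrib)
  finally show ?thesis by simp
qed simp

lemma mult_service_time_le:
  assumes "x \<le> 1"
  shows "m k * x \<le> m k"
  using mult_left_mono[OF assms, of "m k"] service_time_pos[of k] by simp

lemma mult_service_time_le_divide:
  assumes "service_rates y d"
  shows "m k * d l \<le> m k / m l"
  using mult_left_mono[OF service_rate_le_inverse[OF assms], of "m k" l] service_time_pos[of k]
  by simp

lemma drift_eq_0: "y k \<le> 0 \<Longrightarrow> drift y d k = 0"
  by (simp add: drift_def)

lemma drift_overloaded: "0 < y k \<Longrightarrow> drift y d k = m k * a d k - 1"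
  by (simp add: drift_def)

lemma drift_nonpos_of_no_inflow: "a d k = 0 \<Longrightarrow> drift y d k \<le> 0"
  by (simp add: drift_def)

lemma mult_drift_le:
  assumes rates: "service_rates y d" and "a d k = d l" "0 < y k"
  shows "m l * drift y d k \<le> m k - m l"
proof -
  have "m l * d l \<le> 1"
    using service_rate_le_inverse[OF rates, of l] service_time_pos[of l] by (simp add: field_simps)
  then have "m k * (m l * d l) \<le> m k" by (rule mult_service_time_le)
  moreover have "m l * drift y d k = m k * (m l * d l) - m l"
    using assms(2,3) by (simp add: drift_overloaded algebra_simps)
  ultimately show ?thesis by simp
qed

end

locale normalized_stations = two_class_stations +
  assumes station_total: "m k + m (sib k) = 1"
begin

lemma one_le_inverse_service_time: "1 \<le> 1 / m k"
  using service_time_pos[of k] service_time_pos[of "sib k"] station_total[of k]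
  by (simp add: field_simps)

lemma service_time_less_one: "m k < 1"
  using service_time_pos[of "sib k"] station_total[of k] by linarith

lemma service_rate_ge:
  assumes rates: "service_rates y d" and "y (sib k) \<le> 0" and z: "z \<le> a d k" "z \<le> 1"
    and a: "a d (sib k) \<le> 1"
  shows "z \<le> d k"
proof (cases "0 < y k")
  case True
  then show ?thesis
    using overloaded_service_rate(1)[OF rates] one_le_inverse_service_time[of k] z(2) by simp
next
  case False
  then consider "d k = a d k"
    | "m k * d k = q (sib k) * (m k * a d k) + q k * (1 - m (sib k) * a d (sib k))"
    using service_rate_without_overload[OF rates _ assms(2)] by fastforce
  then show ?thesis
  proof cases
    case 2
    have "m (sib k) * a d (sib k) \<le> m (sib k) * 1" "m k * z \<le> m k * 1"
      using a z(2) service_time_pos by (intro mult_left_mono; simp add: less_imp_le)+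
    then have "m k * z \<le> 1 - m (sib k) * a d (sib k)" using station_total[of k] by simp
    then have "q k * (m k * z) \<le> q k * (1 - m (sib k) * a d (sib k))"
      by (rule mult_left_mono) (rule share_nonneg)
    moreover have "q (sib k) * (m k * z) \<le> q (sib k) * (m k * a d k)"
      using z(1) service_time_pos[of k] by (intro mult_left_mono share_nonneg) auto
    moreover have "m k * z = q (sib k) * (m k * z) + q k * (m k * z)"
      using share_add[of k] by (simp add: add.commute flip: distrib_right)
    ultimately have "m k * z \<le> m k * d k"
      unfolding 2 by linarith
    then show ?thesis using service_time_pos[of k] by simp
  qed (use z(1) in simp)
qed

lemma service_rate_le:
  assumes rates: "service_rates y d" and "y k \<le> 0" and a: "a d k \<le> 1 + \<eta>" "1 - \<delta> \<le> a d (sib k)"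
    and "0 \<le> \<eta>" "0 \<le> \<delta>"
  shows "d k \<le> 1 + \<eta> + m (sib k) / m k * \<delta>"
proof -
  have \<delta>: "0 \<le> m (sib k) / m k * \<delta>" using service_time_pos \<open>0 \<le> \<delta>\<close> by (simp add: less_imp_le)
  show ?thesis
  proof (cases "0 < y (sib k)")
    case True
    then show ?thesis using overloaded_service_rate(2)[OF rates True] \<delta> \<open>0 \<le> \<eta>\<close> by simp
  next
    case False
    then consider "d k = a d k"
      | "m k * d k = q (sib k) * (m k * a d k) + q k * (1 - m (sib k) * a d (sib k))"
      using service_rate_without_overload[OF rates assms(2)] by fastforce
    then show ?thesis
    proof cases
      case 2
      define b where "b = m k * (1 + \<eta>) + m (sib k) * \<delta>"
      have nonneg: "0 \<le> m k * \<eta>" "0 \<le> m (sib k) * \<delta>"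
        using service_time_pos \<open>0 \<le> \<eta>\<close> \<open>0 \<le> \<delta>\<close> by (simp_all add: less_imp_le)
      have "m k * a d k \<le> m k * (1 + \<eta>)" "m (sib k) * (1 - \<delta>) \<le> m (sib k) * a d (sib k)"
        using a service_time_pos by simp_all
      then have "m k * a d k \<le> b" "1 - m (sib k) * a d (sib k) \<le> b"
        using nonneg station_total[of k] by (simp_all add: b_def algebra_simps)
      then have "m k * d k \<le> b"
        unfolding 2 using share_nonneg share_add[of k]
        by (intro convex_bound_le) (simp_all add: add.commute)
      also have "b = m k * (1 + \<eta> + m (sib k) / m k * \<delta>)"
        using service_time_pos[of k] by (simp add: b_def distrib_left)
      finally show ?thesis using service_time_pos[of k] by simp
    qed (use a(1) \<delta> in simp)
  qed
qed

lemma service_rates_split: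
  assumes rates: "service_rates y d" and "y k \<le> 0" and "0 < y (sib k) \<or> a d k \<le> 1 \<and> 1 \<le> a d (sib k)"
  shows "d k \<le> 1" "1 \<le> d (sib k)"
proof -
  have "d k \<le> 1 \<and> 1 \<le> d (sib k)"
  proof (cases "0 < y (sib k)")
    case True
    then show ?thesis
      using overloaded_service_rate[OF rates True] one_le_inverse_service_time[of "sib k"] by simp
  next
    case False
    then show ?thesis
      using service_rate_le[OF rates assms(2), of 0 0] service_rate_ge[OF rates, of "sib k" 1] assms(2,3)
      by simp
  qed
  then show "d k \<le> 1" "1 \<le> d (sib k)" by simp_all
qed

text \<open>
  The sibling of each class of the cycle \<open>i\<close>, \<open>j\<close>, \<open>k\<close> feeds the next one. While \<open>i\<close> and \<open>j\<close> are
  overloaded, their siblings are not served, so nothing arrives at \<open>j\<close> and \<open>k\<close>.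
\<close>

lemma weighted_cycle_drift_le:
  assumes rates: "service_rates y d"
    and inflow: "a d i = d (sib k)" "a d j = d (sib i)"
      "a d k = d (sib j)"
    and y: "0 < y i" "0 < y j"
  defines "i' \<equiv> sib i" and "j' \<equiv> sib j" and "k' \<equiv> sib k"
  shows "m i' * m k' * drift y d i + m j' * m i' * drift y d j + m k' * m j' * drift y d k
    \<le> - m i' * (m i' + m j' + m k' - 1)"
proof -
  have "d i' = 0" "d j' = 0"
    using overloaded_service_rate(2)[OF rates] y by (simp_all add: i'_def j'_def)
  then have "drift y d j = - 1" "drift y d k \<le> 0"
    using inflow(2,3) y(2) drift_nonpos_of_no_inflow
    by (simp_all add: drift_overloaded i'_def j'_def)
  moreover have "m k' * drift y d i \<le> 1 - m i' - m k'"
    using mult_drift_le[OF rates inflow(1) y(1)] station_total[of i] by (simp add: i'_def k'_def)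
  ultimately have "m i' * (m k' * drift y d i + m j' * drift y d j) \<le> m i' * (1 - m i' - m k' - m j')"
    "m k' * m j' * drift y d k \<le> 0"
    using service_time_pos by (auto simp: less_imp_le intro!: mult_left_mono mult_nonneg_nonpos)
  then show ?thesis by (simp add: algebra_simps)
qed

end

section \<open>Overload dynamics\<close>

lemma lipschitz_on_weighted_sum:
  fixes f :: "'a \<Rightarrow> 'b::metric_space \<Rightarrow> real"
  assumes "\<And>k. k \<in> A \<Longrightarrow> \<exists>L. L-lipschitz_on S (f k)"
  shows "\<exists>L. L-lipschitz_on S (\<lambda>t. \<Sum>k\<in>A. w k * f k t)"
  using assms
proof (induction A rule: infinite_finite_induct)
  case (insert k A)
  obtain L K where "L-lipschitz_on S (f k)" "K-lipschitz_on S (\<lambda>t. \<Sum>k\<in>A. w k * f k t)"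
    using insert by blast
  then have "(\<bar>w k\<bar> * L + K)-lipschitz_on S (\<lambda>t. w k * f k t + (\<Sum>k\<in>A. w k * f k t))"
    by (intro lipschitz_on_add lipschitz_on_cmult_real)
  then show ?case using insert.hyps by (auto cong: lipschitz_on_cong)
qed (auto intro: lipschitz_on_constant)

locale overload_dynamics = two_class_stations sib m q a
  for sib :: "'k::finite \<Rightarrow> 'k" and m q a +
  fixes y :: "real \<Rightarrow> 'k \<Rightarrow> real"
  assumes overload_nonneg: "0 \<le> y t k"
    and overload_lipschitz: "\<exists>L. L-lipschitz_on {0..} (\<lambda>t. y t k)"
    and overload_deriv: "AE t in lborel. 0 < t \<longrightarrow> (\<exists>d. service_rates (y t) d \<and>
      (\<forall>k. \<exists>D. ((\<lambda>t. y t k) has_real_derivative D) (at t) \<and> D \<le> drift (y t) d k))"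
begin

lemma weighted_overload_deriv:
  assumes w: "\<And>k. 0 \<le> w k"
  shows "AE t in lborel. 0 < t \<longrightarrow> (\<exists>d. service_rates (y t) d \<and>
    (\<exists>D. ((\<lambda>t. \<Sum>k\<in>UNIV. w k * y t k) has_real_derivative D) (at t) \<and>
      D \<le> (\<Sum>k\<in>UNIV. w k * drift (y t) d k)))"
  using overload_deriv
proof eventually_elim
  case (elim t)
  show ?case
  proof
    assume "0 < t"
    then obtain d where rates: "service_rates (y t) d"
      and "\<forall>k. \<exists>D. ((\<lambda>t. y t k) has_real_derivative D) (at t) \<and> D \<le> drift (y t) d k"
      using elim by blast
    then obtain D where D: "\<And>k. ((\<lambda>t. y t k) has_real_derivative D k) (at t)"
      "\<And>k. D k \<le> drift (y t) d k"
      unfolding choice_iff by blast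
    have "((\<lambda>t. \<Sum>k\<in>UNIV. w k * y t k) has_real_derivative (\<Sum>k\<in>UNIV. w k * D k)) (at t)"
      by (intro DERIV_sum DERIV_cmult D(1))
    moreover have "(\<Sum>k\<in>UNIV. w k * D k) \<le> (\<Sum>k\<in>UNIV. w k * drift (y t) d k)"
      by (intro sum_mono mult_left_mono D(2) w)
    ultimately show "\<exists>d. service_rates (y t) d \<and>
      (\<exists>D. ((\<lambda>t. \<Sum>k\<in>UNIV. w k * y t k) has_real_derivative D) (at t) \<and>
        D \<le> (\<Sum>k\<in>UNIV. w k * drift (y t) d k))"
      using rates by blast
  qed
qed

lemma weighted_overload_pos:
  assumes w: "\<And>k. 0 \<le> w k" and "0 < (\<Sum>k\<in>UNIV. w k * y t k)"
  shows "\<exists>k. 0 < w k \<and> 0 < y t k"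
proof (rule ccontr)
  assume none: "\<not> ?thesis"
  have "w k = 0 \<or> y t k = 0" for k
    using none w[of k] overload_nonneg[of t k] by (auto simp: less_le)
  then have "(\<Sum>k\<in>UNIV. w k * y t k) = 0" by (intro sum.neutral) simp
  with assms(2) show False by simp
qed

lemma eventually_not_overloaded_of_weighted_drift:
  assumes w: "\<And>k. 0 \<le> w k" and "0 < c"
    and drift: "\<forall>\<^sub>F t in at_top. \<forall>d. service_rates (y t) d \<longrightarrow> (\<exists>k. 0 < w k \<and> 0 < y t k) \<longrightarrow>
      (\<Sum>k\<in>UNIV. w k * drift (y t) d k) \<le> - c"
    and "0 < w k"
  shows "\<forall>\<^sub>F t in at_top. y t k \<le> 0"
proof -
  define V where "V t = (\<Sum>k\<in>UNIV. w k * y t k)" for t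
  have nonneg: "0 \<le> w k * y t k" for k t using w overload_nonneg by simp
  obtain t0 where drift_le: "\<And>t d. t0 \<le> t \<Longrightarrow> service_rates (y t) d \<Longrightarrow> \<exists>k. 0 < w k \<and> 0 < y t k \<Longrightarrow>
      (\<Sum>k\<in>UNIV. w k * drift (y t) d k) \<le> - c"
    using drift unfolding eventually_at_top_linorder by blast
  obtain L where "L-lipschitz_on {0..} V"
    unfolding V_def using lipschitz_on_weighted_sum[of UNIV "{0..}" "\<lambda>k t. y t k" w] overload_lipschitz
    by blast
  then have "\<forall>\<^sub>F t in at_top. V t = 0"
  proof (rule eventually_zero_of_negative_drift[where a = "max 0 t0", OF _ _ _ \<open>0 < c\<close>])
    show "0 \<le> V t" for t unfolding V_def by (intro sum_nonneg nonneg)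
    show "AE t in lborel. max 0 t0 < t \<longrightarrow> 0 < V t \<longrightarrow> (\<exists>D. (V has_real_derivative D) (at t) \<and> D \<le> - c)"
      using weighted_overload_deriv[of w, OF w] unfolding V_def[symmetric]
    proof eventually_elim
      case (elim t)
      show ?case
      proof (intro impI)
        assume t: "max 0 t0 < t" and "0 < V t"
        then obtain d D where "service_rates (y t) d" "(V has_real_derivative D) (at t)"
          "D \<le> (\<Sum>k\<in>UNIV. w k * drift (y t) d k)"
          using elim by auto
        moreover have "(\<Sum>k\<in>UNIV. w k * drift (y t) d k) \<le> - c"
          using t by (intro drift_le weighted_overload_pos w calculation \<open>0 < V t\<close>[unfolded V_def]) simp
        ultimately show "\<exists>D. (V has_real_derivative D) (at t) \<and> D \<le> - c"
          by (blast intro: order_trans)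
      qed
    qed
  qed simp
  then show ?thesis
  proof eventually_elim
    case (elim t)
    then have "w k * y t k = 0" using nonneg by (simp add: V_def sum_nonneg_eq_0_iff)
    then show ?case using \<open>0 < w k\<close> by simp
  qed
qed

lemma eventually_not_overloaded:
  assumes "r < 1"
    and "\<forall>\<^sub>F t in at_top. \<forall>d. service_rates (y t) d \<longrightarrow> 0 < y t k \<longrightarrow> m k * a d k \<le> r"
  shows "\<forall>\<^sub>F t in at_top. y t k \<le> 0"
proof (rule eventually_not_overloaded_of_weighted_drift[where w = "\<lambda>l. of_bool (l = k)" and c = "1 - r"])
  show "\<forall>\<^sub>F t in at_top. \<forall>d. service_rates (y t) d \<longrightarrow> (\<exists>l. (0::real) < of_bool (l = k) \<and> 0 < y t l) \<longrightarrow>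
      (\<Sum>l\<in>UNIV. of_bool (l = k) * drift (y t) d l) \<le> - (1 - r)"
    using assms(2)
    by eventually_elim (auto simp: drift_def of_bool_def if_distrib[of "\<lambda>c. c * _"] cong: if_cong)
qed (use assms(1) in simp_all)

end

section \<open>The DHV network\<close>

fun dhv_sib :: "dhv_class \<Rightarrow> dhv_class" where
  "dhv_sib K1 = K4"
| "dhv_sib K2 = K5"
| "dhv_sib K3 = K6"
| "dhv_sib K4 = K1"
| "dhv_sib K5 = K2"
| "dhv_sib K6 = K3"

fun dhv_inflow :: "real \<Rightarrow> (dhv_class \<Rightarrow> real) \<Rightarrow> dhv_class \<Rightarrow> real" where
  "dhv_inflow \<alpha> d K1 = \<alpha>"
| "dhv_inflow \<alpha> d K2 = d K1"
| "dhv_inflow \<alpha> d K3 = d K2"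
| "dhv_inflow \<alpha> d K4 = d K3"
| "dhv_inflow \<alpha> d K5 = d K4"
| "dhv_inflow \<alpha> d K6 = d K5"

lemma sum_dhv_class: "sum f (UNIV :: dhv_class set) = f K1 + f K2 + f K3 + f K4 + f K5 + f K6"
  for f :: "dhv_class \<Rightarrow> real"
  by (simp add: UNIV_dhv_class)

lemma all_dhv_class: "(\<forall>k. P k) \<longleftrightarrow> P K1 \<and> P K2 \<and> P K3 \<and> P K4 \<and> P K5 \<and> P K6"
  by (metis dhv_class.exhaust)

lemma ex_dhv_class: "(\<exists>k. P k) \<longleftrightarrow> P K1 \<or> P K2 \<or> P K3 \<or> P K4 \<or> P K5 \<or> P K6"
  by (metis dhv_class.exhaust)

text \<open>
  Bounds the service rates of the classes 4 and 5 while they are not overloaded; it tends to 1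
  as \<open>\<alpha> \<rightarrow> 1\<close>.
\<close>

definition dhv_rate_bound :: "(dhv_class \<Rightarrow> real) \<Rightarrow> real \<Rightarrow> real"
  where "dhv_rate_bound m \<alpha> = 1 + (m K1 / m K4 + m K2 / m K5) * (1 - \<alpha>)"

locale dhv_rates = normalized_stations dhv_sib m q "dhv_inflow \<alpha>"
  for m q :: "dhv_class \<Rightarrow> real" and \<alpha> :: real +
  assumes arrival_rate_le_one: "\<alpha> \<le> 1"
    and heavy_traffic: "m K5 * dhv_rate_bound m \<alpha> < 1" "m K6 * dhv_rate_bound m \<alpha> < 1"
begin

lemma class_2_inflow_le:
  assumes rates: "service_rates y d" and "y K1 \<le> 0" "y K6 \<le> 0" "0 < y K2"
  shows "d K1 \<le> 1"
proof -
  have "1 \<le> d K2" "d K5 \<le> 1"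
    using overloaded_service_rate[OF rates assms(4)] one_le_inverse_service_time[of K2] by simp_all
  then have "1 \<le> d K3" using service_rates_split(2)[OF rates, of K6] assms(3) by simp
  then show ?thesis using service_rates_split(1)[OF rates assms(2)] arrival_rate_le_one by simp
qed

lemma class_3_inflow_le:
  assumes rates: "service_rates y d" and "y K1 \<le> 0" "y K2 \<le> 0" "0 < y K3"
  shows "d K2 \<le> 1"
proof -
  have "1 \<le> d K3"
    using overloaded_service_rate(1)[OF rates assms(4)] one_le_inverse_service_time[of K3] by simp
  then have "d K1 \<le> 1 \<and> 1 \<le> d K4"
    using service_rates_split[OF rates assms(2)] arrival_rate_le_one by simp
  then show ?thesis using service_rates_split(1)[OF rates assms(3)] by simp
qed

lemma class_4_inflow_le:
  assumes rates: "service_rates y d" and "y K2 \<le> 0" "y K3 \<le> 0" "0 < y K4"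
  shows "d K3 \<le> 1"
proof -
  have "d K1 \<le> 1 \<and> 1 \<le> d K4"
    using overloaded_service_rate[OF rates assms(4)] one_le_inverse_service_time[of K4] by simp
  then have "d K2 \<le> 1 \<and> 1 \<le> d K5" using service_rates_split[OF rates assms(2)] by simp
  then show ?thesis using service_rates_split(1)[OF rates assms(3)] by simp
qed

lemma class_4_service_rate_le:
  assumes rates: "service_rates y d" and "y K4 \<le> 0" "d K3 \<le> 1"
  shows "d K4 \<le> 1 + m K1 / m K4 * (1 - \<alpha>)"
  using service_rate_le[OF rates assms(2), of 0 "1 - \<alpha>"] assms(3) arrival_rate_le_one by simp

lemma class_5_inflow_le:
  assumes rates: "service_rates y d" and "y K4 \<le> 0" "y K3 \<le> 0" "0 < y K5"
  shows "d K4 \<le> dhv_rate_bound m \<alpha>"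
proof -
  have "d K2 \<le> 1 \<and> 1 \<le> d K5"
    using overloaded_service_rate[OF rates assms(4)] one_le_inverse_service_time[of K5] by simp
  then have "d K3 \<le> 1" using service_rates_split(1)[OF rates assms(3)] by simp
  then have "d K4 \<le> 1 + m K1 / m K4 * (1 - \<alpha>)" by (rule class_4_service_rate_le[OF rates assms(2)])
  moreover have "0 \<le> m K2 / m K5 * (1 - \<alpha>)"
    using service_time_pos[of K2] service_time_pos[of K5] arrival_rate_le_one by simp
  ultimately show ?thesis by (simp add: dhv_rate_bound_def distrib_right)
qed

lemma class_6_inflow_le:
  assumes rates: "service_rates y d" and "y K4 \<le> 0" "y K5 \<le> 0" "0 < y K6"
  shows "d K5 \<le> dhv_rate_bound m \<alpha>"
proof -
  have inflow_4: "d K3 \<le> 1" using overloaded_service_rate(2)[OF rates assms(4)] by simp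
  have "\<alpha> \<le> d K1" using service_rate_ge[OF rates, of K1 \<alpha>] assms(2) arrival_rate_le_one inflow_4 by simp
  moreover have "d K4 \<le> 1 + m K1 / m K4 * (1 - \<alpha>)"
    by (rule class_4_service_rate_le[OF rates assms(2) inflow_4])
  moreover have "0 \<le> m K1 / m K4 * (1 - \<alpha>)"
    using service_time_pos[of K1] service_time_pos[of K4] arrival_rate_le_one by simp
  ultimately show ?thesis
    using service_rate_le[OF rates assms(3), of "m K1 / m K4 * (1 - \<alpha>)" "1 - \<alpha>"] arrival_rate_le_one
    by (simp add: dhv_rate_bound_def distrib_right)
qed

definition cycle_drift :: "(dhv_class \<Rightarrow> real) \<Rightarrow> (dhv_class \<Rightarrow> real) \<Rightarrow> real" where
  "cycle_drift y d = m K1 * m K3 * drift y d K4 + m K5 * m K1 * drift y d K2 +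
    m K3 * m K5 * drift y d K6"

lemma cycle_drift_two_overloaded:
  assumes "service_rates y d"
  shows "0 < y K4 \<Longrightarrow> 0 < y K2 \<Longrightarrow> cycle_drift y d \<le> - (m K1 * (m K1 + m K3 + m K5 - 1))"
    and "0 < y K2 \<Longrightarrow> 0 < y K6 \<Longrightarrow> cycle_drift y d \<le> - (m K5 * (m K1 + m K3 + m K5 - 1))"
    and "0 < y K6 \<Longrightarrow> 0 < y K4 \<Longrightarrow> cycle_drift y d \<le> - (m K3 * (m K1 + m K3 + m K5 - 1))"
  using weighted_cycle_drift_le[OF assms, of K4 K6 K2] weighted_cycle_drift_le[OF assms, of K2 K4 K6]
    weighted_cycle_drift_le[OF assms, of K6 K2 K4]
  by (simp_all add: cycle_drift_def ac_simps)

lemma cycle_drift_only_2_overloaded: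
  assumes rates: "service_rates y d" and y: "0 < y K2" "y K1 \<le> 0" "y K4 \<le> 0" "y K6 \<le> 0"
  shows "cycle_drift y d \<le> - (m K5 * m K1 * m K5)"
proof -
  have "m K2 * d K1 \<le> m K2"
    by (rule mult_service_time_le) (rule class_2_inflow_le[OF rates y(2,4,1)])
  then have "drift y d K2 \<le> - m K5" using y(1) station_total[of K2] by (simp add: drift_overloaded)
  then have "m K5 * m K1 * drift y d K2 \<le> m K5 * m K1 * - m K5"
    using service_time_pos by (intro mult_left_mono) (simp_all add: less_imp_le)
  then show ?thesis using y by (simp add: cycle_drift_def drift_eq_0)
qed

text \<open>
  Alone, class 4 gains workload only while class 3 is overloaded, and class 6 only while class 5 is;
  the weight \<open>penalty\<close> of the classes 3 and 5 makes their losses outweigh these gains.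
\<close>

definition penalty :: real where
  "penalty = m K1 * m K4 / m K6 + m K3 * m K6 / (1 - m K5 * dhv_rate_bound m \<alpha>)"

lemma penalty_bounds:
  shows "0 < penalty" "m K1 * m K4 \<le> penalty * m K6"
    and "m K3 * m K6 \<le> penalty * (1 - m K5 * dhv_rate_bound m \<alpha>)"
proof -
  define g where "g = 1 - m K5 * dhv_rate_bound m \<alpha>"
  have pos: "0 < m k" "0 < g" for k using service_time_pos heavy_traffic(1) by (simp_all add: g_def)
  show "0 < penalty"
    unfolding penalty_def g_def[symmetric] using pos by (intro add_pos_pos) simp_all
  have "penalty * m K6 = m K1 * m K4 + m K3 * m K6 / g * m K6"
    using pos(1)[of K6] by (simp add: penalty_def g_def[symmetric] distrib_right)
  moreover have "0 \<le> m K3 * m K6 / g * m K6" using pos by (simp add: less_imp_le)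
  ultimately show "m K1 * m K4 \<le> penalty * m K6" by simp
  have "penalty * g = m K1 * m K4 / m K6 * g + m K3 * m K6"
    using pos(2) by (simp add: penalty_def g_def[symmetric] distrib_right)
  moreover have "0 \<le> m K1 * m K4 / m K6 * g" using pos by (simp add: less_imp_le)
  ultimately show "m K3 * m K6 \<le> penalty * (1 - m K5 * dhv_rate_bound m \<alpha>)" by (simp add: g_def)
qed

lemma class_3_drift_le:
  assumes "service_rates y d" "y K1 \<le> 0" "y K2 \<le> 0" "0 < y K3"
  shows "drift y d K3 \<le> - m K6"
  using mult_service_time_le[OF class_3_inflow_le[OF assms], of K3] assms(4) station_total[of K3]
  by (simp add: drift_overloaded)

lemma class_5_drift_le:
  assumes "service_rates y d" "y K4 \<le> 0" "y K3 \<le> 0" "0 < y K5"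
  shows "drift y d K5 \<le> - (1 - m K5 * dhv_rate_bound m \<alpha>)"
  using mult_left_mono[OF class_5_inflow_le[OF assms], of "m K5"] assms(4) service_time_pos[of K5]
  by (simp add: drift_overloaded)

definition lyapunov_drift :: "(dhv_class \<Rightarrow> real) \<Rightarrow> (dhv_class \<Rightarrow> real) \<Rightarrow> real" where
  "lyapunov_drift y d = cycle_drift y d + penalty * (drift y d K3 + drift y d K5)"

lemma penalized_drift_only_4_overloaded:
  assumes rates: "service_rates y d" and y: "0 < y K4" "y K1 \<le> 0" "y K2 \<le> 0" "y K6 \<le> 0"
  shows "cycle_drift y d + penalty * drift y d K3 \<le> - (m K1 * m K3 * m K1)"
proof (cases "0 < y K3")
  case True
  have "m K1 * (m K3 * drift y d K4) \<le> m K1 * (m K4 - m K3)"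
    using mult_drift_le[OF rates, of K4 K3] y(1) service_time_pos[of K1]
    by (intro mult_left_mono) simp_all
  moreover have "penalty * drift y d K3 \<le> penalty * - m K6"
    using class_3_drift_le[OF rates y(2,3) True] penalty_bounds(1)
    by (intro mult_left_mono) simp_all
  moreover have "m K1 * m K3 * m K1 \<le> m K1 * m K3 * 1"
    using service_time_less_one[of K1] service_time_pos
    by (intro mult_left_mono) (simp_all add: less_imp_le)
  ultimately show ?thesis
    using y penalty_bounds(2) by (simp add: cycle_drift_def drift_eq_0 right_diff_distrib)
next
  case False
  then have "m K4 * d K3 \<le> m K4"
    using mult_service_time_le[OF class_4_inflow_le[OF rates y(3) _ y(1)], of K4] by simp
  then have "drift y d K4 \<le> - m K1" using y(1) station_total[of K1] by (simp add: drift_overloaded)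
  then have "m K1 * m K3 * drift y d K4 \<le> m K1 * m K3 * - m K1"
    using service_time_pos by (intro mult_left_mono) (simp_all add: less_imp_le)
  then show ?thesis using y False by (simp add: cycle_drift_def drift_eq_0)
qed

lemma penalized_drift_only_6_overloaded:
  assumes rates: "service_rates y d" and y: "0 < y K6" "y K2 \<le> 0" "y K4 \<le> 0"
  shows "cycle_drift y d + penalty * drift y d K5 \<le> - (m K3 * m K5 * (1 - m K6 * dhv_rate_bound m \<alpha>))"
proof (cases "0 < y K5")
  case True
  have "y K3 \<le> 0" using sib_not_overloaded[OF rates y(1)] by simp
  then have "penalty * drift y d K5 \<le> penalty * - (1 - m K5 * dhv_rate_bound m \<alpha>)"
    using class_5_drift_le[OF rates y(3) _ True] penalty_bounds(1)
    by (intro mult_left_mono) simp_all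
  moreover have "m K3 * (m K5 * drift y d K6) \<le> m K3 * (m K6 - m K5)"
    using mult_drift_le[OF rates, of K6 K5] y(1) service_time_pos[of K3]
    by (intro mult_left_mono) simp_all
  moreover have "0 \<le> m K3 * m K5 * (m K6 * dhv_rate_bound m \<alpha>)"
    using service_time_pos arrival_rate_le_one unfolding dhv_rate_bound_def
    by (simp add: less_imp_le)
  ultimately show ?thesis
    using y penalty_bounds(3) by (simp add: cycle_drift_def drift_eq_0 algebra_simps)
next
  case False
  have "m K6 * d K5 \<le> m K6 * dhv_rate_bound m \<alpha>"
    using class_6_inflow_le[OF rates y(3) _ y(1)] False service_time_pos[of K6]
    by (intro mult_left_mono) simp_all
  then have "m K3 * m K5 * drift y d K6 \<le> m K3 * m K5 * - (1 - m K6 * dhv_rate_bound m \<alpha>)"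
    using y(1) service_time_pos
    by (intro mult_left_mono) (simp_all add: drift_overloaded less_imp_le)
  then show ?thesis
    unfolding mult_minus_right using y False by (simp add: cycle_drift_def drift_eq_0)
qed

lemma penalized_drift_nonpos:
  assumes rates: "service_rates y d" and "m K5 \<le> m K4" "m K5 \<le> m K6"
  shows "drift y d K3 \<le> 0" "drift y d K5 \<le> 0"
proof -
  have "m K2 * drift y d K3 \<le> 0" if "0 < y K3"
    using mult_drift_le[OF rates, of K3 K2] that assms(3) station_total[of K2] station_total[of K3]
    by simp
  then show "drift y d K3 \<le> 0"
    using service_time_pos[of K2] by (cases "0 < y K3") (auto simp: drift_eq_0 mult_le_0_iff)
  have "m K4 * drift y d K5 \<le> 0" if "0 < y K5"
    using mult_drift_le[OF rates, of K5 K4] that assms(2) by simp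
  then show "drift y d K5 \<le> 0"
    using service_time_pos[of K4] by (cases "0 < y K5") (auto simp: drift_eq_0 mult_le_0_iff)
qed

lemma penalized_drift_cycle_empty:
  assumes rates: "service_rates y d" and order: "m K5 \<le> m K4" "m K5 \<le> m K6"
    and y: "y K1 \<le> 0" "y K2 \<le> 0" "y K4 \<le> 0" "y K6 \<le> 0" "0 < y K3 \<or> 0 < y K5"
  shows "penalty * (drift y d K3 + drift y d K5) \<le>
    - (penalty * min (m K6) (1 - m K5 * dhv_rate_bound m \<alpha>))"
proof -
  have "drift y d K3 + drift y d K5 \<le> - min (m K6) (1 - m K5 * dhv_rate_bound m \<alpha>)"
  proof (cases "0 < y K3")
    case True
    then show ?thesis
      using class_3_drift_le[OF rates y(1,2)] penalized_drift_nonpos(2)[OF rates order] by simp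
  next
    case False
    then show ?thesis using class_5_drift_le[OF rates y(3)] y(5) by (simp add: drift_eq_0)
  qed
  then have "penalty * (drift y d K3 + drift y d K5) \<le>
      penalty * - min (m K6) (1 - m K5 * dhv_rate_bound m \<alpha>)"
    using penalty_bounds(1) by (intro mult_left_mono) simp_all
  then show ?thesis by simp
qed

definition drift_margins :: "real set" where
  "drift_margins = {m K1 * (m K1 + m K3 + m K5 - 1), m K5 * (m K1 + m K3 + m K5 - 1),
    m K3 * (m K1 + m K3 + m K5 - 1), m K5 * m K1 * m K5, m K1 * m K3 * m K1,
    m K3 * m K5 * (1 - m K6 * dhv_rate_bound m \<alpha>),
    penalty * min (m K6) (1 - m K5 * dhv_rate_bound m \<alpha>)}"

lemma drift_margin_pos:
  assumes "m K2 + m K4 + m K6 < 2" "c \<in> drift_margins"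
  shows "0 < c"
proof -
  have "0 < m K1 + m K3 + m K5 - 1"
    using assms(1) station_total[of K1] station_total[of K2] station_total[of K3] by simp
  then show ?thesis
    using assms(2) service_time_pos heavy_traffic penalty_bounds(1) unfolding drift_margins_def
    by auto
qed

lemma cycle_drift_le_margin:
  assumes "service_rates y d"
    and "0 < y K4 \<and> 0 < y K2 \<or> 0 < y K2 \<and> 0 < y K6 \<or> 0 < y K6 \<and> 0 < y K4"
  shows "\<exists>c\<in>drift_margins. cycle_drift y d \<le> - c"
  using assms(2) cycle_drift_two_overloaded[OF assms(1)] unfolding drift_margins_def by blast

lemma lyapunov_drift_le:
  assumes "service_rates y d" "m K5 \<le> m K4" "m K5 \<le> m K6"
    and "cycle_drift y d \<le> x \<or> cycle_drift y d + penalty * drift y d K3 \<le> x \<or>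
      cycle_drift y d + penalty * drift y d K5 \<le> x"
  shows "lyapunov_drift y d \<le> x"
proof -
  have "penalty * drift y d K3 \<le> 0" "penalty * drift y d K5 \<le> 0"
    using penalized_drift_nonpos[OF assms(1-3)] penalty_bounds(1) by (simp_all add: mult_le_0_iff)
  then show ?thesis using assms(4) by (auto simp: lyapunov_drift_def distrib_left)
qed

lemma lyapunov_drift_le_margin:
  assumes rates: "service_rates y d" and order: "m K5 \<le> m K4" "m K5 \<le> m K6"
    and y: "y K1 \<le> 0" "\<exists>k. k \<noteq> K1 \<and> 0 < y k"
  shows "\<exists>c\<in>drift_margins. lyapunov_drift y d \<le> - c"
proof -
  note le = lyapunov_drift_le[OF rates order]
  have "0 < y K2 \<or> 0 < y K3 \<or> 0 < y K4 \<or> 0 < y K5 \<or> 0 < y K6" using y(2) by (simp add: ex_dhv_class)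
  then consider "0 < y K4 \<and> 0 < y K2 \<or> 0 < y K2 \<and> 0 < y K6 \<or> 0 < y K6 \<and> 0 < y K4"
    | "0 < y K2" "y K4 \<le> 0" "y K6 \<le> 0" | "0 < y K4" "y K2 \<le> 0" "y K6 \<le> 0"
    | "0 < y K6" "y K2 \<le> 0" "y K4 \<le> 0"
    | "y K2 \<le> 0" "y K4 \<le> 0" "y K6 \<le> 0" "0 < y K3 \<or> 0 < y K5"
    by argo
  then show ?thesis
  proof cases
    case 1
    then show ?thesis using cycle_drift_le_margin[OF rates] le by blast
  next
    case 2
    show ?thesis
      using le cycle_drift_only_2_overloaded[OF rates 2(1) y(1) 2(2,3)] unfolding drift_margins_def by blast
  next
    case 3
    show ?thesis
      using le penalized_drift_only_4_overloaded[OF rates 3(1) y(1) 3(2,3)] unfolding drift_margins_def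
      by blast
  next
    case 4
    show ?thesis
      using le penalized_drift_only_6_overloaded[OF rates 4] unfolding drift_margins_def by blast
  next
    case 5
    then have "cycle_drift y d = 0" by (simp add: cycle_drift_def drift_eq_0)
    then show ?thesis
      using penalized_drift_cycle_empty[OF rates order y(1) 5]
      by (simp add: lyapunov_drift_def drift_margins_def)
  qed
qed

lemma lyapunov_drift_negative:
  assumes "m K5 \<le> m K4" "m K5 \<le> m K6" "m K2 + m K4 + m K6 < 2"
  obtains c where "0 < c"
    and "\<And>y d. service_rates y d \<Longrightarrow> y K1 \<le> 0 \<Longrightarrow> \<exists>k. k \<noteq> K1 \<and> 0 < y k \<Longrightarrow>
      lyapunov_drift y d \<le> - c"
proof
  have finite: "finite drift_margins" "drift_margins \<noteq> {}" by (simp_all add: drift_margins_def)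
  then show "0 < Min drift_margins" using drift_margin_pos[OF assms(3)] by simp
  fix y d
  assume "service_rates y d" "y K1 \<le> 0" "\<exists>k. k \<noteq> K1 \<and> 0 < y k"
  from lyapunov_drift_le_margin[OF this(1) assms(1,2) this(2,3)]
  obtain c where "c \<in> drift_margins" "lyapunov_drift y d \<le> - c" by blast
  then show "lyapunov_drift y d \<le> - Min drift_margins"
    using Min_le[OF finite(1)] by fastforce
qed

end

section \<open>Collapse of the DHV network\<close>

locale dhv_dynamics = dhv_rates m q \<alpha> + overload_dynamics dhv_sib m q "dhv_inflow \<alpha>" y
  for m q :: "dhv_class \<Rightarrow> real" and \<alpha> :: real and y :: "real \<Rightarrow> dhv_class \<Rightarrow> real"
begin

lemma eventually_class_1_not_overloaded: "\<forall>\<^sub>F t in at_top. y t K1 \<le> 0"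
  by (rule eventually_not_overloaded[OF service_time_less_one[of K1]])
    (simp add: mult_service_time_le arrival_rate_le_one)

lemma eventually_no_overload_of_class_2:
  assumes class_2: "\<forall>\<^sub>F t in at_top. y t K2 \<le> 0"
  shows "\<forall>\<^sub>F t in at_top. y t k \<le> 0"
proof -
  note class_1 = eventually_class_1_not_overloaded
  have "\<forall>\<^sub>F t in at_top. \<forall>d. service_rates (y t) d \<longrightarrow> 0 < y t K3 \<longrightarrow> m K3 * dhv_inflow \<alpha> d K3 \<le> m K3"
    using class_1 class_2 by eventually_elim (simp add: class_3_inflow_le mult_service_time_le)
  then have class_3: "\<forall>\<^sub>F t in at_top. y t K3 \<le> 0"
    by (rule eventually_not_overloaded[OF service_time_less_one])
  have "\<forall>\<^sub>F t in at_top. \<forall>d. service_rates (y t) d \<longrightarrow> 0 < y t K4 \<longrightarrow> m K4 * dhv_inflow \<alpha> d K4 \<le> m K4"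
    using class_2 class_3 by eventually_elim (simp add: class_4_inflow_le mult_service_time_le)
  then have class_4: "\<forall>\<^sub>F t in at_top. y t K4 \<le> 0"
    by (rule eventually_not_overloaded[OF service_time_less_one])
  have "\<forall>\<^sub>F t in at_top. \<forall>d. service_rates (y t) d \<longrightarrow> 0 < y t K5 \<longrightarrow>
      m K5 * dhv_inflow \<alpha> d K5 \<le> m K5 * dhv_rate_bound m \<alpha>"
    using class_4 class_3 by eventually_elim (simp add: class_5_inflow_le service_time_pos)
  then have class_5: "\<forall>\<^sub>F t in at_top. y t K5 \<le> 0"
    by (rule eventually_not_overloaded[OF heavy_traffic(1)])
  have "\<forall>\<^sub>F t in at_top. \<forall>d. service_rates (y t) d \<longrightarrow> 0 < y t K6 \<longrightarrow>
      m K6 * dhv_inflow \<alpha> d K6 \<le> m K6 * dhv_rate_bound m \<alpha>"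
    using class_4 class_5 by eventually_elim (simp add: class_6_inflow_le service_time_pos)
  then have class_6: "\<forall>\<^sub>F t in at_top. y t K6 \<le> 0"
    by (rule eventually_not_overloaded[OF heavy_traffic(2)])
  show ?thesis using class_1 class_2 class_3 class_4 class_5 class_6 by (cases k) simp_all
qed

lemma eventually_no_overload_of_fast_class_2:
  assumes "m K2 < m K1"
  shows "\<forall>\<^sub>F t in at_top. y t k \<le> 0"
proof (rule eventually_no_overload_of_class_2)
  have "\<forall>\<^sub>F t in at_top. \<forall>d. service_rates (y t) d \<longrightarrow> 0 < y t K2 \<longrightarrow>
      m K2 * dhv_inflow \<alpha> d K2 \<le> m K2 / m K1"
    using mult_service_time_le_divide by simp
  then show "\<forall>\<^sub>F t in at_top. y t K2 \<le> 0"
    using assms service_time_pos[of K1]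
    by (intro eventually_not_overloaded[of "m K2 / m K1"]) simp_all
qed

lemma eventually_no_overload_of_fast_class_6:
  assumes "m K6 < m K5"
  shows "\<forall>\<^sub>F t in at_top. y t k \<le> 0"
proof (rule eventually_no_overload_of_class_2)
  have "\<forall>\<^sub>F t in at_top. \<forall>d. service_rates (y t) d \<longrightarrow> 0 < y t K6 \<longrightarrow>
      m K6 * dhv_inflow \<alpha> d K6 \<le> m K6 / m K5"
    using mult_service_time_le_divide by simp
  then have class_6: "\<forall>\<^sub>F t in at_top. y t K6 \<le> 0"
    using assms service_time_pos[of K5]
    by (intro eventually_not_overloaded[of "m K6 / m K5"]) simp_all
  have "\<forall>\<^sub>F t in at_top. \<forall>d. service_rates (y t) d \<longrightarrow> 0 < y t K2 \<longrightarrow> m K2 * dhv_inflow \<alpha> d K2 \<le> m K2"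
    using eventually_class_1_not_overloaded class_6
    by eventually_elim (simp add: class_2_inflow_le mult_service_time_le)
  then show "\<forall>\<^sub>F t in at_top. y t K2 \<le> 0"
    by (rule eventually_not_overloaded[OF service_time_less_one])
qed

lemma eventually_no_overload_of_slow_classes_2_6:
  assumes order: "m K5 \<le> m K4" "m K5 \<le> m K6" and virtual: "m K2 + m K4 + m K6 < 2"
  shows "\<forall>\<^sub>F t in at_top. y t k \<le> 0"
proof (cases "k = K1")
  case False
  define w where "w = (\<lambda>k. case k of K1 \<Rightarrow> 0 | K2 \<Rightarrow> m K1 * m K5 | K3 \<Rightarrow> penalty | K4 \<Rightarrow> m K1 * m K3
    | K5 \<Rightarrow> penalty | K6 \<Rightarrow> m K3 * m K5)"
  have w_pos: "0 < w k \<longleftrightarrow> k \<noteq> K1" for k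
    using service_time_pos penalty_bounds(1) by (cases k) (simp_all add: w_def)
  have w_nonneg: "0 \<le> w k" for k using w_pos[of k] by (cases "k = K1") (simp_all add: w_def)
  have sum_w: "(\<Sum>k\<in>UNIV. w k * drift x d k) = lyapunov_drift x d" for x d
    by (simp add: sum_dhv_class w_def lyapunov_drift_def cycle_drift_def distrib_left mult.commute)
  obtain c where "0 < c" and drift_le: "\<And>x d. service_rates x d \<Longrightarrow> x K1 \<le> 0 \<Longrightarrow> \<exists>k. k \<noteq> K1 \<and> 0 < x k \<Longrightarrow>
      lyapunov_drift x d \<le> - c"
    by (rule lyapunov_drift_negative[OF assms]) blast
  have "\<forall>\<^sub>F t in at_top. \<forall>d. service_rates (y t) d \<longrightarrow> (\<exists>k. 0 < w k \<and> 0 < y t k) \<longrightarrow>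
      (\<Sum>k\<in>UNIV. w k * drift (y t) d k) \<le> - c"
    using eventually_class_1_not_overloaded by eventually_elim (use drift_le in \<open>simp add: sum_w w_pos\<close>)
  then show ?thesis
    using False
    by (intro eventually_not_overloaded_of_weighted_drift[of w c] w_nonneg \<open>0 < c\<close>) (simp_all add: w_pos)
qed (simp add: eventually_class_1_not_overloaded)

lemma eventually_no_overload:
  assumes "m K2 + m K4 + m K6 < 2"
  shows "\<forall>\<^sub>F t in at_top. y t k \<le> 0"
proof -
  consider "m K2 < m K1" | "m K6 < m K5" | "m K5 \<le> m K4" "m K5 \<le> m K6"
    using station_total[of K1] station_total[of K2] unfolding dhv_sib.simps by linarith
  then show ?thesis
    by cases (simp_all add: eventually_no_overload_of_fast_class_2 eventually_no_overload_of_fast_class_6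
        eventually_no_overload_of_slow_classes_2_6 assms)
qed

end

section \<open>Matrices of a multiclass network\<close>

lemma matrix_inv_mult_vec_eq:
  fixes A :: "real ^ 'n ^ 'n"
  assumes "\<And>x. A *v x = 0 \<Longrightarrow> x = 0" and "A *v x = b"
  shows "matrix_inv A *v b = x"
proof -
  have "invertible A"
    using assms(1) by (simp add: invertible_left_inverse matrix_left_invertible_ker)
  then have "matrix_inv A ** A = mat 1"
    unfolding invertible_def matrix_inv_def by (rule someI2_ex) simp
  then show ?thesis using assms(2) by (metis matrix_vector_mul_assoc matrix_vector_mul_lid)
qed

lemma service_matrix_mult_vec: "service_matrix m *v x = (\<chi> k. m $ k * x $ k)"
  by (simp add: vec_eq_iff matrix_vector_mult_def service_matrix_def if_distrib[of "\<lambda>c. c * _"]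
      cong: if_cong)

lemma matrix_inv_service_matrix_mult_vec:
  assumes "\<And>k. m $ k \<noteq> 0"
  shows "matrix_inv (service_matrix m) *v x = (\<chi> k. x $ k / m $ k)"
  by (rule matrix_inv_mult_vec_eq) (use assms in \<open>simp_all add: service_matrix_mult_vec vec_eq_iff\<close>)

lemma constituency_matrix_mult_vec:
  "constituency_matrix s *v x = (\<chi> j. \<Sum>k\<in>UNIV. if s k = j then x $ k else 0)"
  by (simp add: vec_eq_iff matrix_vector_mult_def constituency_matrix_def if_distrib[of "\<lambda>c. c * _"]
      cong: if_cong)

lemma workload_matrix_mult_vec:
  "(constituency_matrix s ** service_matrix m) *v x =
    (\<chi> j. \<Sum>k\<in>UNIV. if s k = j then m $ k * x $ k else 0)"
  by (simp add: matrix_vector_mul_assoc[symmetric] service_matrix_mult_vec constituency_matrix_mult_vec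
      cong: if_cong)

lemma routing_mult_vec_nth:
  fixes P :: "real ^ 'k ^ 'k"
  shows "((mat 1 - transpose P) *v x) $ k = x $ k - (\<Sum>l\<in>UNIV. P $ l $ k * x $ l)"
  by (simp add: matrix_vector_mult_diff_rdistrib vector_matrix_mult_def mult.commute)

lemma traffic_intensity_nth:
  fixes P :: "real ^ 'k ^ 'k"
  assumes "\<And>x. (mat 1 - transpose P) *v x = 0 \<Longrightarrow> x = 0" and "(mat 1 - transpose P) *v r = \<alpha>"
  shows "traffic_intensity P s m \<alpha> $ j = (\<Sum>k\<in>UNIV. if s k = j then m $ k * r $ k else 0)"
  by (simp add: traffic_intensity_def matrix_vector_mul_assoc[symmetric] matrix_inv_mult_vec_eq[OF assms]
      service_matrix_mult_vec constituency_matrix_mult_vec cong: if_cong)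

section \<open>Fluid solutions of networks with two classes per station\<close>

lemma has_vector_derivative_vec_lambda:
  fixes f :: "real \<Rightarrow> real ^ 'n"
  assumes "\<And>k. ((\<lambda>t. f t $ k) has_real_derivative D k) (at t)"
  shows "(f has_vector_derivative (\<chi> k. D k)) (at t)"
  unfolding has_vector_derivative_def
proof (subst has_derivative_componentwise_within, safe)
  fix i :: "real ^ 'n" assume "i \<in> Basis"
  then obtain k where i: "i = axis k 1" by (auto simp: Basis_vec_def)
  show "((\<lambda>x. f x \<bullet> i) has_derivative (\<lambda>x. (x *\<^sub>R (\<chi> k. D k)) \<bullet> i)) (at t)"
    using assms[of k]
    by (simp add: i inner_axis has_field_derivative_def mult.commute[of "D k"] mult_commute_abs)
qed

lemma lipschitz_on_vec_nth:
  assumes "L-lipschitz_on S f"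
  shows "L-lipschitz_on S (\<lambda>t. f t $ k)"
  using lipschitz_onD[OF assms] lipschitz_on_nonneg[OF assms]
  by (intro lipschitz_onI) (auto intro: order_trans[OF dist_vec_nth_le])

lemma interval_measure_integral_zero_imp_const:
  fixes F w :: "real \<Rightarrow> real"
  assumes F: "mono F" "\<And>a. continuous (at_right a) F" and "a \<le> b" "{a<..b} \<subseteq> A"
    and "0 < c" and w: "\<And>s. a < s \<Longrightarrow> s \<le> b \<Longrightarrow> c \<le> w s"
    and integral: "(\<integral>\<^sup>+ s\<in>A. ennreal (w s) \<partial>interval_measure F) = 0"
  shows "F b = F a"
proof -
  have "ennreal c * ennreal (F b - F a) = ennreal c * emeasure (interval_measure F) {a<..b}"
    using emeasure_interval_measure_Ioc[of a b F] F \<open>a \<le> b\<close> by (simp add: monoD)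
  also have "\<dots> = (\<integral>\<^sup>+ s. ennreal c * indicator {a<..b} s \<partial>interval_measure F)"
    by (subst nn_integral_cmult_indicator) auto
  also have "\<dots> \<le> (\<integral>\<^sup>+ s\<in>A. ennreal (w s) \<partial>interval_measure F)"
    using assms(4) w by (intro nn_integral_mono) (auto simp: indicator_def intro: ennreal_leI)
  finally have "F b \<le> F a" using \<open>0 < c\<close> integral by (simp add: ennreal_eq_0_iff)
  then show ?thesis using monoD[OF F(1) \<open>a \<le> b\<close>] by simp
qed

lemma complementarity_derivative_zero:
  fixes y w :: "real \<Rightarrow> real"
  assumes y: "mono_on {0..} y" "continuous_on {0..} y" and w: "continuous_on {0..} w"
    and integral: "(\<integral>\<^sup>+ s\<in>{0..}. ennreal (w s) \<partial>interval_measure (\<lambda>s. y (max 0 s))) = 0"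
    and t: "0 < t" "0 < w t" and D: "(y has_real_derivative D) (at t)"
  shows "D = 0"
proof -
  let ?F = "\<lambda>s. y (max 0 s)"
  have "continuous_on {0<..} w" using w by (rule continuous_on_subset) auto
  then have "isCont w t" using t by (simp add: continuous_on_eq_continuous_at)
  then have "\<forall>\<^sub>F s in nhds t. w t / 2 < w s"
    unfolding isCont_def tendsto_at_iff_tendsto_nhds by (rule order_tendstoD) (use t in simp)
  then obtain e where e: "0 < e" "\<And>s. dist s t < e \<Longrightarrow> w t / 2 < w s"
    unfolding eventually_nhds_metric by blast
  define r where "r = min (e / 2) (t / 2)"
  have r: "0 < r" "r < e" "r < t" using e t by (auto simp: r_def)
  have F_mono: "mono ?F" by (intro monoI mono_onD[OF y(1)]) auto
  have "continuous_on UNIV ?F"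
    by (rule continuous_on_compose2[OF y(2)]) (auto intro!: continuous_intros)
  then have F_cont: "continuous (at_right a) ?F" for a
    by (simp add: continuous_on_eq_continuous_within continuous_at_imp_continuous_at_within)
  have "?F (t + r) = ?F (t - r)"
  proof (rule interval_measure_integral_zero_imp_const[OF F_mono F_cont _ _ _ _ integral])
    fix s assume "t - r < s" "s \<le> t + r"
    then have "dist s t < e" unfolding dist_real_def using r(2) by linarith
    then show "w t / 2 \<le> w s" using e(2) by (simp add: less_imp_le)
  qed (use r t in auto)
  then have "y t = y s" if "\<bar>t - s\<bar> < r" for s
    using monoD[OF F_mono, of "t - r" s] monoD[OF F_mono, of s "t + r"] monoD[OF F_mono, of "t - r" t]
      monoD[OF F_mono, of t "t + r"] that r by (auto simp: abs_less_iff)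
  then show ?thesis by (intro DERIV_local_const[OF D r(1)]) simp
qed

definition inflow :: "('k, 'k) rmatrix \<Rightarrow> 'k::{finite,linorder} rvector \<Rightarrow> ('k \<Rightarrow> real) \<Rightarrow> 'k \<Rightarrow> real"
  where "inflow P \<alpha> d k = \<alpha> $ k + (\<Sum>l\<in>UNIV. P $ l $ k * d l)"

locale two_class_fluid =
  fixes P :: "('k::{finite,linorder}, 'k) rmatrix" and s :: "'k \<Rightarrow> 'j::finite" and sib :: "'k \<Rightarrow> 'k"
    and m \<alpha> :: "'k rvector" and \<Delta> :: "('k, 'j) rmatrix"
    and Z :: "real \<Rightarrow> 'k rvector" and W :: "real \<Rightarrow> 'j rvector" and \<epsilon> T :: "real \<Rightarrow> 'k rvector"
    and Y :: "real \<Rightarrow> 'j rvector"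
  assumes same_station_iff: "s l = s k \<longleftrightarrow> l = k \<or> l = sib k" and sib_neq: "sib k \<noteq> k"
    and m_pos: "0 < m $ k" and P_nonneg: "0 \<le> P $ l $ k" and \<alpha>_nonneg: "0 \<le> \<alpha> $ k"
    and ratio: "ratio_matrix s m \<Delta>" and fluid: "fluid_solution P s m \<alpha> \<Delta> Z W \<epsilon> T Y"
begin

lemma
  shows W_lipschitz: "\<exists>L. L-lipschitz_on {0..} W" and \<epsilon>_lipschitz: "\<exists>L. L-lipschitz_on {0..} \<epsilon>"
    and T_lipschitz: "\<exists>L. L-lipschitz_on {0..} T" and Y_lipschitz: "\<exists>L. L-lipschitz_on {0..} Y"
    and Z_eq: "0 \<le> t \<Longrightarrow>
      Z t = Z 0 + t *\<^sub>R \<alpha> - ((mat 1 - transpose P) ** matrix_inv (service_matrix m)) *v T t"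
    and Z_nonneg: "0 \<le> t \<Longrightarrow> 0 \<le> Z t $ k"
    and W_eq: "0 \<le> t \<Longrightarrow> W t = (constituency_matrix s ** service_matrix m) *v Z t"
    and \<epsilon>_eq: "0 \<le> t \<Longrightarrow> \<epsilon> t = Z t - \<Delta> *v W t"
    and T_mono: "mono_on {0..} (\<lambda>t. T t $ k)"
    and Y_eq: "0 \<le> t \<Longrightarrow> Y t = t *\<^sub>R (\<chi> j. 1) - constituency_matrix s *v T t"
    and Y_mono: "mono_on {0..} (\<lambda>t. Y t $ j)"
    and complementarity: "(\<integral>\<^sup>+ t\<in>{0..}. ennreal (W t $ j) \<partial>interval_measure (\<lambda>t. Y (max 0 t) $ j)) = 0"
    and priority: "0 < t \<Longrightarrow> (T has_vector_derivative T') (at t) \<Longrightarrow>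
      (\<Sum>i\<in>excess_classes s (\<epsilon> t) k. \<epsilon> t $ i) * (1 - (\<Sum>i\<in>excess_classes s (\<epsilon> t) k. T' $ i)) = 0"
  using fluid unfolding fluid_solution_def by meson+

lemma sib_sib: "sib (sib k) = k"
  using same_station_iff[of "sib k" k] same_station_iff[of k "sib k"] sib_neq[of k] by auto

lemma sum_station: "(\<Sum>l\<in>UNIV. if s l = s k then f l else 0) = f k + f (sib k)"
  for f :: "'k \<Rightarrow> real"
proof -
  have "{l. s l = s k} = {k, sib k}" by (auto simp: same_station_iff)
  then show ?thesis using sib_neq[of k] by (simp add: sum.If_cases)
qed

lemma workload_eq: "0 \<le> t \<Longrightarrow> W t $ s k = m $ k * Z t $ k + m $ sib k * Z t $ sib k"
  by (simp add: W_eq workload_matrix_mult_vec sum_station)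

lemma idleness_eq: "0 \<le> t \<Longrightarrow> Y t $ s k = t - (T t $ k + T t $ sib k)"
  by (simp add: Y_eq constituency_matrix_mult_vec sum_station)

lemma queue_eq:
  assumes "0 \<le> t"
  shows "Z t $ k = Z 0 $ k + t * \<alpha> $ k - (T t $ k / m $ k - (\<Sum>l\<in>UNIV. P $ l $ k * (T t $ l / m $ l)))"
  by (subst Z_eq[OF assms])
    (simp add: matrix_vector_mul_assoc[symmetric] matrix_inv_service_matrix_mult_vec
      m_pos[THEN less_imp_neq, symmetric] routing_mult_vec_nth)

definition share :: "'k \<Rightarrow> real"
  where "share k = m $ k * \<Delta> $ k $ s k"

lemma share_nonneg: "0 \<le> share k"
  using ratio m_pos[of k] by (simp add: share_def ratio_matrix_def less_imp_le)

lemma share_add: "share k + share (sib k) = 1"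
proof -
  have "(constituency_matrix s ** service_matrix m) *v (\<Delta> *v axis (s k) 1) = axis (s k) 1"
    using ratio by (simp add: ratio_matrix_def matrix_vector_mul_assoc)
  then have "((constituency_matrix s ** service_matrix m) *v (\<Delta> *v axis (s k) 1)) $ s k = 1"
    by simp
  moreover have "s (sib k) = s k" by (simp add: same_station_iff)
  ultimately show ?thesis
    by (simp add: workload_matrix_mult_vec sum_station share_def matrix_vector_mult_basis column_def)
qed

lemma target_queue_eq: "(\<Delta> *v w) $ k = \<Delta> $ k $ s k * w $ s k"
proof -
  have "(\<Sum>j\<in>UNIV. \<Delta> $ k $ j * w $ j) = (\<Sum>j\<in>{s k}. \<Delta> $ k $ j * w $ j)"
    using ratio by (intro sum.mono_neutral_right) (auto simp: ratio_matrix_def)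
  then show ?thesis by (simp add: matrix_vector_mult_def)
qed

lemma imbalance_eq:
  assumes "0 \<le> t"
  shows "m $ k * \<epsilon> t $ k = share (sib k) * (m $ k * Z t $ k) - share k * (m $ sib k * Z t $ sib k)"
proof -
  have "m $ k * \<epsilon> t $ k = m $ k * Z t $ k - share k * (m $ k * Z t $ k + m $ sib k * Z t $ sib k)"
    using assms by (simp add: \<epsilon>_eq target_queue_eq workload_eq share_def right_diff_distrib)
  also have "\<dots> = (1 - share k) * (m $ k * Z t $ k) - share k * (m $ sib k * Z t $ sib k)"
    by (simp add: algebra_simps)
  also have "1 - share k = share (sib k)" using share_add[of k] by simp
  finally show ?thesis .
qed

lemma imbalance_sib: "0 \<le> t \<Longrightarrow> m $ sib k * \<epsilon> t $ sib k = - (m $ k * \<epsilon> t $ k)"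
  by (simp add: imbalance_eq sib_sib)

lemma share_sib_pos:
  assumes "0 \<le> t" "0 < \<epsilon> t $ k"
  shows "0 < share (sib k)"
proof (rule ccontr)
  assume "\<not> ?thesis"
  then have "share (sib k) = 0" using share_nonneg[of "sib k"] by simp
  then have "m $ k * \<epsilon> t $ k \<le> 0"
    using imbalance_eq[OF assms(1), of k] share_nonneg[of k] Z_nonneg[OF assms(1), of "sib k"]
      m_pos[of "sib k"] by simp
  then show False using assms(2) m_pos[of k] by (simp add: mult_le_0_iff)
qed

text \<open>
  Dividing by the share of the sibling lets the overload fall at rate 1 when nothing arrives, whatever
  \<open>\<Delta>\<close> is. If that share is \<open>0\<close>, then \<open>\<epsilon>\<^sub>k \<le> 0\<close> and the quotient has the right value \<open>0\<close>.
\<close>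

definition overload :: "real \<Rightarrow> 'k \<Rightarrow> real"
  where "overload t k = max 0 (m $ k * \<epsilon> t $ k) / share (sib k)"

lemma overload_nonneg: "0 \<le> overload t k"
  using share_nonneg by (simp add: overload_def)

lemma overload_pos_iff:
  assumes "0 \<le> t"
  shows "0 < overload t k \<longleftrightarrow> 0 < \<epsilon> t $ k"
  using share_sib_pos[OF assms, of k] m_pos[of k] share_nonneg[of "sib k"]
  by (auto simp: overload_def zero_less_divide_iff less_max_iff_disj zero_less_mult_iff)

lemma imbalance_eq_overload_diff:
  assumes "0 \<le> t"
  shows "m $ k * \<epsilon> t $ k = share (sib k) * overload t k - share k * overload t (sib k)"
proof -
  have "share (sib l) * overload t l = max 0 (m $ l * \<epsilon> t $ l)" for l
  proof (cases "0 < \<epsilon> t $ l")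
    case False
    then have "m $ l * \<epsilon> t $ l \<le> 0" using m_pos[of l] by (simp add: mult_le_0_iff)
    then show ?thesis by (simp add: overload_def)
  qed (use share_sib_pos[OF assms, of l] in \<open>simp add: overload_def\<close>)
  from this[of k] this[of "sib k"] show ?thesis by (simp add: sib_sib imbalance_sib[OF assms])
qed

lemma overload_lipschitz: "\<exists>L. L-lipschitz_on {0..} (\<lambda>t. overload t k)"
proof -
  obtain L where "L-lipschitz_on {0..} \<epsilon>" using \<epsilon>_lipschitz by blast
  then have "(\<bar>1 / share (sib k)\<bar> * (\<bar>m $ k\<bar> * L))-lipschitz_on {0..}
      (\<lambda>t. 1 / share (sib k) * max 0 (m $ k * \<epsilon> t $ k))"
    by (intro lipschitz_on_cmult_real lipschitz_on_max_const lipschitz_on_vec_nth)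
  then show ?thesis unfolding overload_def by auto
qed

sublocale two_class_stations sib "($) m" share "inflow P \<alpha>"
  by unfold_locales (simp_all add: sib_sib m_pos share_nonneg share_add)

end

locale two_class_fluid_derivative = two_class_fluid P s sib m \<alpha> \<Delta> Z W \<epsilon> T Y
  for P :: "('k::{finite,linorder}, 'k) rmatrix" and s :: "'k \<Rightarrow> 'j::finite" and sib m \<alpha> \<Delta> Z W \<epsilon> T Y +
  fixes t :: real and u v :: "'k \<Rightarrow> real"
  assumes t_pos: "0 < t"
    and T_deriv: "((\<lambda>t. T t $ k) has_real_derivative u k) (at t)"
    and overload_has_deriv: "((\<lambda>t. overload t k) has_real_derivative v k) (at t)"
begin

definition departure_rate :: "'k \<Rightarrow> real"
  where "departure_rate k = u k / m $ k"

lemma mult_departure_rate: "m $ k * departure_rate k = u k"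
  using m_pos[of k] by (simp add: departure_rate_def)

lemma u_nonneg: "0 \<le> u k"
  using mono_on_imp_deriv_nonneg[OF T_mono T_deriv] t_pos by (simp add: interior_real_atLeast)

lemma departure_rate_nonneg: "0 \<le> departure_rate k"
  using u_nonneg[of k] m_pos[of k] by (simp add: departure_rate_def)

lemma inflow_nonneg: "0 \<le> inflow P \<alpha> departure_rate k"
  using \<alpha>_nonneg P_nonneg departure_rate_nonneg by (simp add: inflow_def sum_nonneg)

lemma deriv_halfline_cong:
  assumes "(g has_real_derivative D) (at t)" "\<And>r. 0 \<le> r \<Longrightarrow> f r = g r"
  shows "(f has_real_derivative D) (at t)"
  using has_field_derivative_transform_within_open[OF assms(1), of "{0<..}" f] t_pos assms(2)
  by simp

lemma Z_deriv:
  "((\<lambda>t. Z t $ k) has_real_derivative inflow P \<alpha> departure_rate k - departure_rate k) (at t)"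
proof (rule deriv_halfline_cong)
  have "((\<lambda>t. Z 0 $ k + t * \<alpha> $ k - (T t $ k / m $ k - (\<Sum>l\<in>UNIV. P $ l $ k * (T t $ l / m $ l))))
      has_real_derivative 0 + 1 * \<alpha> $ k - (u k / m $ k - (\<Sum>l\<in>UNIV. P $ l $ k * (u l / m $ l)))) (at t)"
    by (intro DERIV_diff DERIV_add DERIV_const DERIV_cmult_right DERIV_ident DERIV_sum
        DERIV_cmult DERIV_cdivide T_deriv)
  then show "((\<lambda>t. Z 0 $ k + t * \<alpha> $ k - (T t $ k / m $ k - (\<Sum>l\<in>UNIV. P $ l $ k * (T t $ l / m $ l))))
      has_real_derivative inflow P \<alpha> departure_rate k - departure_rate k) (at t)"
    by (simp add: inflow_def departure_rate_def algebra_simps)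
qed (rule queue_eq)

lemma Y_deriv: "((\<lambda>t. Y t $ s k) has_real_derivative 1 - (u k + u (sib k))) (at t)"
  by (rule deriv_halfline_cong[OF DERIV_diff[OF DERIV_ident DERIV_add[OF T_deriv T_deriv]] idleness_eq])

lemma capacity: "u k + u (sib k) \<le> 1"
  using mono_on_imp_deriv_nonneg[OF Y_mono Y_deriv] t_pos by (simp add: interior_real_atLeast)

lemma overloaded_rate:
  assumes "0 < overload t k"
  shows "u k = 1"
proof -
  have t: "0 \<le> t" using t_pos by simp
  have pos: "0 < \<epsilon> t $ k" using assms overload_pos_iff[OF t] by blast
  have "m $ sib k * \<epsilon> t $ sib k < 0" using imbalance_sib[OF t, of k] pos m_pos[of k] by simp
  then have "\<not> 0 < \<epsilon> t $ sib k" using m_pos[of "sib k"] by (simp add: mult_less_0_iff)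
  then have "excess_classes s (\<epsilon> t) k = {k}"
    using pos by (auto simp: excess_classes_def same_station_iff)
  then show ?thesis
    using priority[OF t_pos has_vector_derivative_vec_lambda[OF T_deriv], of k] pos by simp
qed

lemma work_conservation: "u k + u (sib k) = 1 \<or> departure_rate k = inflow P \<alpha> departure_rate k"
proof (cases "0 < W t $ s k")
  case True
  have "continuous_on {0..} (\<lambda>t. Y t $ s k)" "continuous_on {0..} (\<lambda>t. W t $ s k)"
    using Y_lipschitz W_lipschitz lipschitz_on_vec_nth lipschitz_on_continuous_on by blast+
  then have "1 - (u k + u (sib k)) = 0"
    using complementarity_derivative_zero[OF Y_mono _ _ complementarity t_pos True Y_deriv] by blast
  then show ?thesis by simp
next
  case False
  have "0 \<le> m $ k * Z t $ k" "0 \<le> m $ sib k * Z t $ sib k"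
    using Z_nonneg m_pos t_pos by (simp_all add: less_imp_le)
  then have "m $ k * Z t $ k = 0" using False workload_eq[of t k] t_pos by linarith
  then have "Z t $ k = 0" using m_pos[of k] by simp
  then show ?thesis using DERIV_zero_at_halfline_min[OF Z_deriv t_pos _ Z_nonneg] by simp
qed

lemma overload_deriv_zero:
  assumes "\<not> 0 < overload t k"
  shows "v k = 0"
  using DERIV_zero_at_halfline_min[OF overload_has_deriv t_pos _ overload_nonneg] assms
    overload_nonneg[of t k] by simp

lemma overload_deriv_balance:
  "share (sib k) * v k - share k * v (sib k) =
    share (sib k) * (m $ k * (inflow P \<alpha> departure_rate k - departure_rate k)) -
    share k * (m $ sib k * (inflow P \<alpha> departure_rate (sib k) - departure_rate (sib k)))"
proof (rule DERIV_unique)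
  show "((\<lambda>t. m $ k * \<epsilon> t $ k) has_real_derivative share (sib k) * v k - share k * v (sib k)) (at t)"
    by (rule deriv_halfline_cong[OF DERIV_diff[OF DERIV_cmult DERIV_cmult] imbalance_eq_overload_diff])
      (rule overload_has_deriv)+
  show "((\<lambda>t. m $ k * \<epsilon> t $ k) has_real_derivative
      share (sib k) * (m $ k * (inflow P \<alpha> departure_rate k - departure_rate k)) -
      share k * (m $ sib k * (inflow P \<alpha> departure_rate (sib k) - departure_rate (sib k)))) (at t)"
    by (rule deriv_halfline_cong[OF DERIV_diff[OF DERIV_cmult[OF DERIV_cmult] DERIV_cmult[OF DERIV_cmult]]
          imbalance_eq])
      (rule Z_deriv)+
qed

lemma sib_rate_zero:
  assumes "0 < overload t k"
  shows "\<not> 0 < overload t (sib k)" "departure_rate (sib k) = 0"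
proof -
  show "departure_rate (sib k) = 0"
    using capacity[of k] overloaded_rate[OF assms] u_nonneg[of "sib k"]
    by (simp add: departure_rate_def)
  then show "\<not> 0 < overload t (sib k)"
    using overloaded_rate[of "sib k"] mult_departure_rate[of "sib k"] by auto
qed

lemma overload_deriv_le_drift: "v k \<le> drift (overload t) departure_rate k"
proof (cases "0 < overload t k")
  case True
  have "0 < share (sib k)" using share_sib_pos[of t k] overload_pos_iff[of t k] True t_pos by simp
  have "0 \<le> share k * (m $ sib k * inflow P \<alpha> departure_rate (sib k))"
    using share_nonneg m_pos inflow_nonneg by (simp add: less_imp_le)
  moreover have "share (sib k) * v k =
      share (sib k) * (m $ k * inflow P \<alpha> departure_rate k - 1) -
      share k * (m $ sib k * inflow P \<alpha> departure_rate (sib k))"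
    using overload_deriv_balance[of k] overload_deriv_zero[OF sib_rate_zero(1)[OF True]]
      sib_rate_zero(2)[OF True] mult_departure_rate[of k] overloaded_rate[OF True]
    by (simp add: right_diff_distrib)
  ultimately have "share (sib k) * v k \<le> share (sib k) * (m $ k * inflow P \<alpha> departure_rate k - 1)"
    by linarith
  then show ?thesis using True \<open>0 < share (sib k)\<close> by (simp add: drift_def)
qed (simp add: drift_def overload_deriv_zero)

lemma service_rates_overload: "service_rates (overload t) departure_rate"
  unfolding service_rates_def
proof (intro allI conjI impI)
  fix k
  assume "overload t k \<le> 0" "overload t (sib k) \<le> 0"
  then show "share (sib k) * (m $ k * (inflow P \<alpha> departure_rate k - departure_rate k)) =
      share k * (m $ sib k * (inflow P \<alpha> departure_rate (sib k) - departure_rate (sib k)))"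
    using overload_deriv_balance[of k] overload_deriv_zero[of k] overload_deriv_zero[of "sib k"]
    by simp
qed (use departure_rate_nonneg capacity overloaded_rate work_conservation in
    \<open>simp_all add: mult_departure_rate\<close>)

end

context two_class_fluid
begin

lemma AE_overload_deriv:
  "AE t in lborel. 0 < t \<longrightarrow> (\<exists>d. service_rates (overload t) d \<and>
    (\<forall>k. \<exists>D. ((\<lambda>t. overload t k) has_real_derivative D) (at t) \<and> D \<le> drift (overload t) d k))"
proof -
  have "AE t in lborel. 0 < t \<longrightarrow> (\<exists>D. ((\<lambda>t. T t $ k) has_real_derivative D) (at t))" for k
    using T_lipschitz lipschitz_on_vec_nth lipschitz_halfline_AE_differentiable by blast
  then have "AE t in lborel. \<forall>k\<in>UNIV. 0 < t \<longrightarrow> (\<exists>D. ((\<lambda>t. T t $ k) has_real_derivative D) (at t))"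
    by (intro AE_finite_allI) simp_all
  moreover have "AE t in lborel. 0 < t \<longrightarrow> (\<exists>D. ((\<lambda>t. overload t k) has_real_derivative D) (at t))" for k
    using overload_lipschitz[of k] lipschitz_halfline_AE_differentiable by blast
  then have "AE t in lborel. \<forall>k\<in>UNIV. 0 < t \<longrightarrow> (\<exists>D. ((\<lambda>t. overload t k) has_real_derivative D) (at t))"
    by (intro AE_finite_allI) simp_all
  ultimately show ?thesis
  proof eventually_elim
    case (elim t)
    show ?case
    proof
      assume t: "0 < t"
      then have "\<forall>k. \<exists>D. ((\<lambda>t. T t $ k) has_real_derivative D) (at t)"
        and "\<forall>k. \<exists>D. ((\<lambda>t. overload t k) has_real_derivative D) (at t)" using elim by simp_all
      then obtain u v where uv: "\<And>k. ((\<lambda>t. T t $ k) has_real_derivative u k) (at t)"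
        "\<And>k. ((\<lambda>t. overload t k) has_real_derivative v k) (at t)" unfolding choice_iff by blast
      interpret two_class_fluid_derivative P s sib m \<alpha> \<Delta> Z W \<epsilon> T Y t u v
        by unfold_locales (rule t uv)+
      show "\<exists>d. service_rates (overload t) d \<and>
          (\<forall>k. \<exists>D. ((\<lambda>t. overload t k) has_real_derivative D) (at t) \<and> D \<le> drift (overload t) d k)"
        using service_rates_overload overload_deriv_le_drift uv(2) by blast
    qed
  qed
qed

sublocale overload_dynamics sib "($) m" share "inflow P \<alpha>" overload
  by unfold_locales (rule overload_nonneg overload_lipschitz AE_overload_deriv)+

lemma balanced_of_no_overload:
  assumes "0 \<le> t" "\<And>k. overload t k \<le> 0"
  shows "Z t = \<Delta> *v W t"
proof -
  have "\<epsilon> t $ k = 0" for k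
  proof -
    have "\<epsilon> t $ l \<le> 0" for l using overload_pos_iff[OF assms(1), of l] assms(2)[of l] by linarith
    then have "m $ l * \<epsilon> t $ l \<le> 0" for l using m_pos[of l] by (simp add: mult_le_0_iff)
    from this[of k] this[of "sib k"] have "m $ k * \<epsilon> t $ k = 0"
      using imbalance_sib[OF assms(1), of k] by simp
    then show ?thesis using m_pos[of k] by simp
  qed
  then have "\<epsilon> t = 0" by (simp add: vec_eq_iff)
  then show ?thesis using \<epsilon>_eq[OF assms(1)] by simp
qed

lemma eventually_balanced:
  assumes "\<And>k. \<forall>\<^sub>F t in at_top. overload t k \<le> 0"
  shows "\<exists>t\<^sub>0\<ge>0. \<forall>t\<ge>t\<^sub>0. Z t = \<Delta> *v W t"
proof -
  have "\<forall>\<^sub>F t in at_top. \<forall>k. overload t k \<le> 0" using assms by (simp add: eventually_all_finite)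
  then have "\<forall>\<^sub>F t in at_top. Z t = \<Delta> *v W t"
    using eventually_ge_at_top[of 0] by eventually_elim (simp add: balanced_of_no_overload)
  then obtain N where "\<And>t. N \<le> t \<Longrightarrow> Z t = \<Delta> *v W t" unfolding eventually_at_top_linorder by blast
  then show ?thesis by (intro exI[of _ "max 0 N"]) simp
qed

end

section \<open>Fluid solutions of the DHV network\<close>

lemma inflow_dhv: "inflow dhv_routing (dhv_arrivals \<alpha>) = dhv_inflow \<alpha>"
proof (intro ext)
  show "inflow dhv_routing (dhv_arrivals \<alpha>) d k = dhv_inflow \<alpha> d k" for d k
    by (cases k) (simp_all add: inflow_def sum_dhv_class dhv_routing_def dhv_arrivals_def)
qed

lemma dhv_station_eq_iff: "dhv_station l = dhv_station k \<longleftrightarrow> l = k \<or> l = dhv_sib k"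
  by (cases k; cases l) simp_all

lemma dhv_traffic_intensity_3: "dhv_traffic_intensity m \<alpha>\<^sub>1 $ 3 = (m $ K3 + m $ K6) * \<alpha>\<^sub>1"
proof -
  have "dhv_traffic_intensity m \<alpha>\<^sub>1 $ 3 =
      (\<Sum>k\<in>UNIV. if dhv_station k = 3 then m $ k * (\<chi> k. \<alpha>\<^sub>1) $ k else 0)"
    by (rule traffic_intensity_nth)
      (simp_all add: vec_eq_iff all_dhv_class routing_mult_vec_nth sum_dhv_class dhv_routing_def
        dhv_arrivals_def)
  then show ?thesis by (simp add: sum_dhv_class distrib_right)
qed

lemma dhv_state_space_collapse:
  fixes m :: "real ^ dhv_class"
  assumes m: "\<And>k. 0 < m $ k" "m $ K1 + m $ K4 = 1" "m $ K2 + m $ K5 = 1" "m $ K3 + m $ K6 = 1"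
    and \<alpha>: "0 \<le> \<alpha>" "\<alpha> \<le> 1"
    and heavy: "m $ K5 * dhv_rate_bound (($) m) \<alpha> < 1" "m $ K6 * dhv_rate_bound (($) m) \<alpha> < 1"
    and virtual: "m $ K2 + m $ K4 + m $ K6 < 2" and ratio: "ratio_matrix dhv_station m \<Delta>"
  shows "state_space_collapse dhv_routing dhv_station m (dhv_arrivals \<alpha>) \<Delta>"
  unfolding state_space_collapse_def
proof (intro allI impI)
  fix Z W \<epsilon> T Y
  assume fluid: "fluid_solution dhv_routing dhv_station m (dhv_arrivals \<alpha>) \<Delta> Z W \<epsilon> T Y"
  interpret two_class_fluid dhv_routing dhv_station dhv_sib m "dhv_arrivals \<alpha>" \<Delta> Z W \<epsilon> T Y
  proof
    show "dhv_sib k \<noteq> k" for k by (cases k) simp_all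
  qed (use dhv_station_eq_iff m(1) \<alpha>(1) ratio fluid in \<open>simp_all add: dhv_routing_def dhv_arrivals_def\<close>)
  have "overload_dynamics dhv_sib (($) m) share (dhv_inflow \<alpha>) overload"
    using overload_dynamics_axioms unfolding inflow_dhv .
  moreover have "m $ k + m $ dhv_sib k = 1" for k using m(2-4) by (cases k) simp_all
  ultimately interpret dhv: dhv_dynamics "($) m" share \<alpha> overload
    using \<alpha>(2) heavy
    by (intro dhv_dynamics.intro dhv_rates.intro dhv_rates_axioms.intro normalized_stations.intro
        normalized_stations_axioms.intro) (auto dest: overload_dynamics.axioms(1))
  show "\<exists>t\<^sub>0\<ge>0. \<forall>t\<ge>t\<^sub>0. Z t = \<Delta> *v W t"
    by (rule eventually_balanced[OF dhv.eventually_no_overload[OF virtual]])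
qed

lemma eventually_dhv_rate_bound_less:
  assumes "m k < 1"
  shows "\<forall>\<^sub>F \<alpha> in at_left 1. m k * dhv_rate_bound m \<alpha> < 1"
proof -
  have "((\<lambda>\<alpha>. m k * dhv_rate_bound m \<alpha>) \<longlongrightarrow> m k * dhv_rate_bound m 1) (at_left 1)"
    unfolding dhv_rate_bound_def by (intro tendsto_intros)
  then show ?thesis by (rule order_tendstoD) (use assms in \<open>simp add: dhv_rate_bound_def\<close>)
qed

theorem corollary4:
  fixes m :: "real ^ dhv_class"
  assumes "\<And>k. 0 < m $ k"
    and "m $ K1 + m $ K4 = 1" and "m $ K2 + m $ K5 = 1" and "m $ K3 + m $ K6 = 1"
  shows "\<exists>\<alpha>bar::real. 0 < \<alpha>bar \<and> \<alpha>bar < 1 \<and>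
    (\<forall>\<alpha>\<^sub>1::real. \<alpha>bar < \<alpha>\<^sub>1 \<longrightarrow>
      dhv_traffic_intensity m \<alpha>\<^sub>1 $ 1 = dhv_traffic_intensity m \<alpha>\<^sub>1 $ 2 \<longrightarrow>
      dhv_traffic_intensity m \<alpha>\<^sub>1 $ 2 = dhv_traffic_intensity m \<alpha>\<^sub>1 $ 3 \<longrightarrow>
      dhv_traffic_intensity m \<alpha>\<^sub>1 $ 3 < 1 \<longrightarrow>
      m $ K2 + m $ K4 + m $ K6 < 2 \<longrightarrow>
      (\<forall>\<Delta>. ratio_matrix dhv_station m \<Delta> \<longrightarrow>
        state_space_collapse dhv_routing dhv_station m (dhv_arrivals \<alpha>\<^sub>1) \<Delta>))"
proof -
  have "m $ K5 < 1" "m $ K6 < 1" using assms(1)[of K2] assms(1)[of K3] assms(3,4) by linarith+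
  then have "\<forall>\<^sub>F \<alpha> in at_left 1. m $ K5 * dhv_rate_bound (($) m) \<alpha> < 1 \<and>
      m $ K6 * dhv_rate_bound (($) m) \<alpha> < 1"
    by (intro eventually_conj eventually_dhv_rate_bound_less)
  then obtain b where b: "b < 1"
    "\<And>\<alpha>. b < \<alpha> \<Longrightarrow> \<alpha> < 1 \<Longrightarrow> m $ K5 * dhv_rate_bound (($) m) \<alpha> < 1 \<and> m $ K6 * dhv_rate_bound (($) m) \<alpha> < 1"
    unfolding eventually_at_left[OF zero_less_one] by blast
  show ?thesis
  proof (intro exI[of _ "max b (1 / 2)"] conjI allI impI)
    fix \<alpha>\<^sub>1 :: real and \<Delta>
    assume "max b (1 / 2) < \<alpha>\<^sub>1" "dhv_traffic_intensity m \<alpha>\<^sub>1 $ 3 < 1"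
      and "m $ K2 + m $ K4 + m $ K6 < 2" "ratio_matrix dhv_station m \<Delta>"
    moreover from this have "b < \<alpha>\<^sub>1" "0 \<le> \<alpha>\<^sub>1" "\<alpha>\<^sub>1 < 1"
      by (simp_all add: dhv_traffic_intensity_3 assms(4))
    ultimately show "state_space_collapse dhv_routing dhv_station m (dhv_arrivals \<alpha>\<^sub>1) \<Delta>"
      using b(2) by (intro dhv_state_space_collapse assms) simp_all
  qed (use b(1) in simp_all)
qed

end
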